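(* Let $\mathcal A$ and $\mathfrak A$ be Banach algebras such that $\mathcal A$ is a Banach $\mathfrak A$-bimodule with compatible actions, and let $n\ge0$ be an integer. A bounded linear map $D:\mathcal A\rtimes\mathfrak A\to(\mathcal A\rtimes\mathfrak A)^{(2n)}$ is a derivation if and only if there exist derivations $D^2_{\mathfrak A}:\mathfrak A\to\mathfrak A^{(2n)}$ and $D^1_{\mathfrak A}:\mathfrak A\to\mathcal A^{(2n)}$, a bounded $\mathfrak A$-bimodule map $D^2_{\mathcal A}:\mathcal A\to\mathfrak A^{(2n)}$ and a bounded linear map $D^1_{\mathcal A}:\mathcal A\to\mathcal A^{(2n)}$ such that for all $a,b\in\mathcal A$ and $\beta\in\mathfrak A$: (i) $D((a,\beta))=(D^1_{\mathcal A}(a)+D^1_{\mathfrak A}(\beta),\ D^2_{\mathcal A}(a)+D^2_{\mathfrak A}(\beta))$; (ii) $D^1_{\mathcal A}(ab)=D^1_{\mathcal A}(a)\circ b+D^2_{\mathcal A}(a)\bullet b+a\vartriangle D^1_{\mathcal A}(b)+a\blacktriangle D^2_{\mathcal A}(b)$; (iii) $D^1_{\mathcal A}(\beta\cdot a)=D^1_{\mathfrak A}(\beta)\circ a+D^2_{\mathfrak A}(\beta)\bullet a+\beta\blacktriangle D^1_{\mathcal A}(a)$; (iv) $D^1_{\mathcal A}(a\cdot\beta)=a\vartriangle D^1_{\mathfrak A}(\beta)+a\blacktriangle D^2_{\mathfrak A}(\beta)+D^1_{\mathcal A}(a)\bullet\beta$; (v) $D^2_{\mathcal A}(ab)=0$.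 Moreover, if $D$ is such a derivation, $a^{(2n)}\in\mathcal A^{(2n)}$ and $\beta^{(2n)}\in\mathfrak A^{(2n)}$, then $D=\mathrm{ad}_{(a^{(2n)},\beta^{(2n)})}$ if and only if $D^1_{\mathfrak A}=\mathrm{ad}_{a^{(2n)}}$ (on $\mathfrak A$), $D^2_{\mathfrak A}=\mathrm{ad}_{\beta^{(2n)}}$, $D^2_{\mathcal A}=0$ and $$D^1_{\mathcal A}(a)=\mathrm{ad}_{a^{(2n)}}(a)+a\blacktriangle\beta^{(2n)}-\beta^{(2n)}\bullet a\qquad\text{for all }a\in\mathcal A.$$
   Context: The actions of $\mathfrak A$ on $\mathcal A$ are compatible if for all $a,b\in\mathcal A$ and $\beta\in\mathfrak A$: $\beta\cdot(ab)=(\beta\cdot a)b$, $(ab)\cdot\beta=a(b\cdot\beta)$, $a(\beta\cdot b)=(a\cdot\beta)b$. The amalgamated duplication $\mathcal A\rtimes\mathfrak A$ is $\mathcal A\times\mathfrak A$ with product $(a,\beta)(b,\gamma)=(ab+a\cdot\gamma+\beta\cdot b,\ \beta\gamma)$ and norm $\|(a,\beta)\|=\|a\|+\|\beta\|$. $\mathcal Y^{(k)}$ is the $k$-th dual of a Banach space $\mathcal Y$ ($\mathcal Y^{(0)}=\mathcal Y$), and $(\mathcal A\rtimes\mathfrak A)^{(k)}$ is identified with $\mathcal A^{(k)}\times\mathfrak A^{(k)}$ via the coordinatewise pairing. If $\mathcal X$ is a Banach $\mathcal C$-bimodule, its dual is one via $\langle x^{(1)}\cdot c,x\rangle=\langle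 x^{(1)},c\cdot x\rangle$, $\langle c\cdot x^{(1)},x\rangle=\langle x^{(1)},x\cdot c\rangle$; iterating gives the bimodule structure on every $\mathcal X^{(k)}$. For $a\in\mathcal A$, $\beta\in\mathfrak A$ write: $a\vartriangle x$, $x\circ a$ for the left and right actions of $\mathcal A$ on $x\in\mathcal A^{(k)}$; $\beta\vartriangle y$, $y\circ\beta$ for the left and right actions of $\mathfrak A$ on $y\in\mathfrak A^{(k)}$; $\beta\blacktriangle x$, $x\bullet\beta$ for the left and right actions of $\mathfrak A$ on $x\in\mathcal A^{(k)}$ (all induced by iterated dualization from the products and from the given bimodule action). Mixed operations: for $y\in\mathfrak A^{(2m)}$ the elements $a\blacktriangle y,\ y\bullet a\in\mathcal A^{(2m)}$ and for $x\in\mathcal A^{(2m+1)}$ the elements $a\blacktriangle x,\ x\bullet a\in\mathfrak A^{(2m+1)}$ are defined recursively by: for $m=0$, $a\blacktriangle y=a\cdot y$ and $y\bullet a=y\cdot a$; $\langle a\blacktriangle x,y\rangle=\langle x,y\bullet a\rangle$ and $\langle x\bullet a,y\rangle=\langle x,a\blacktriangle y\rangle$ for $x\in\mathcal A^{(2m+1)}$, $y\in\mathfrak A^{(2m)}$; $\langle a\blacktriangle y,x\rangle=\langle y,x\bullet a\rangle$ and $\langle y\bullet a,x\rangle=\langle y,a\blacktriangle x\rangle$ for $y\in\mathfrak A^{(2m+2)}$, $x\in\mathcal A^{(2m+1)}$. A derivation from a Banach algebra $\mathcal C$ into a Banach $\mathcal C$-bimodule $\mathcal X$ is a continuous linear map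 $D$ with $D(c_1c_2)=D(c_1)\cdot c_2+c_1\cdot D(c_2)$; for $x\in\mathcal X$, $\mathrm{ad}_x(c)=c\cdot x-x\cdot c$. For $x\in\mathcal A^{(2n)}$, $\mathrm{ad}_x$ on $\mathcal A$ (resp. on $\mathfrak A$) uses the $\mathcal A$-bimodule (resp. $\mathfrak A$-bimodule) structure of $\mathcal A^{(2n)}$. *)

theory Defs
  imports "HOL-Analysis.Analysis" "HOL-Library.Function_Algebras"
begin

section \<open>Normed spaces over the real or complex field\<close>

text \<open>
  The order \<open>k\<close> of an iterated dual is a number, so the duals of all orders have to be sets in
  one type. A normed space is therefore a subspace of an ambient vector space (addition is that
  of the type, which carries no topology) together with its own scalar multiplication and norm.
  The scalars form an arbitrary \<open>real_normed_field\<close>; up to isometric isomorphism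
  these are exactly the real and the complex numbers.
\<close>

record ('k, 'u) nspace =
  pts :: "'u set"
  scale :: "'k \<Rightarrow> 'u \<Rightarrow> 'u"
  nrm :: "'u \<Rightarrow> real"

definition normed_space :: "('k::real_normed_field, 'u::ab_group_add) nspace \<Rightarrow> bool" where
  "normed_space X \<longleftrightarrow>
     vector_space (scale X) \<and> module.subspace (scale X) (pts X) \<and>
     (\<forall>x\<in>pts X. 0 \<le> nrm X x \<and> (nrm X x = 0 \<longleftrightarrow> x = 0)) \<and>
     (\<forall>c. \<forall>x\<in>pts X. nrm X (scale X c x) = norm c * nrm X x) \<and>
     (\<forall>x\<in>pts X. \<forall>y\<in>pts X. nrm X (x + y) \<le> nrm X x + nrm X y)"

definition banach_space :: "('k::real_normed_field, 'u::ab_group_add) nspace \<Rightarrow> bool" where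
  "banach_space X \<longleftrightarrow> normed_space X \<and>
     (\<forall>s :: nat \<Rightarrow> 'u. (\<forall>i. s i \<in> pts X) \<and>
        (\<forall>e>0. \<exists>N. \<forall>i\<ge>N. \<forall>j\<ge>N. nrm X (s i - s j) < e)
        \<longrightarrow> (\<exists>x\<in>pts X. (\<lambda>i. nrm X (s i - x)) \<longlonglongrightarrow> 0))"

definition bounded_linear_map ::
  "('k::real_normed_field, 'u::ab_group_add) nspace \<Rightarrow> ('k, 'v::ab_group_add) nspace
     \<Rightarrow> ('u \<Rightarrow> 'v) \<Rightarrow> bool" where
  "bounded_linear_map X Y f \<longleftrightarrow>
     (\<forall>x\<in>pts X. f x \<in> pts Y) \<and>
     (\<forall>x\<in>pts X. \<forall>y\<in>pts X. f (x + y) = f x + f y) \<and>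
     (\<forall>c. \<forall>x\<in>pts X. f (scale X c x) = scale Y c (f x)) \<and>
     (\<exists>K. \<forall>x\<in>pts X. nrm Y (f x) \<le> K * nrm X x)"

definition bounded_bilinear_map ::
  "('k::real_normed_field, 'u::ab_group_add) nspace \<Rightarrow> ('k, 'v::ab_group_add) nspace
     \<Rightarrow> ('k, 'w::ab_group_add) nspace \<Rightarrow> ('u \<Rightarrow> 'v \<Rightarrow> 'w) \<Rightarrow> bool" where
  "bounded_bilinear_map X Y Z f \<longleftrightarrow>
     (\<forall>x\<in>pts X. \<forall>y\<in>pts Y. f x y \<in> pts Z) \<and>
     (\<forall>x\<in>pts X. \<forall>x'\<in>pts X. \<forall>y\<in>pts Y. f (x + x') y = f x y + f x' y) \<and>
     (\<forall>x\<in>pts X. \<forall>y\<in>pts Y. \<forall>y'\<in>pts Y. f x (y + y') = f x y + f x y') \<and>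
     (\<forall>c. \<forall>x\<in>pts X. \<forall>y\<in>pts Y.
        f (scale X c x) y = scale Z c (f x y) \<and> f x (scale Y c y) = scale Z c (f x y)) \<and>
     (\<exists>K. \<forall>x\<in>pts X. \<forall>y\<in>pts Y. nrm Z (f x y) \<le> K * nrm X x * nrm Y y)"

definition scalars :: "('k::real_normed_field, 'k) nspace" where
  "scalars = \<lparr>pts = UNIV, scale = (*), nrm = norm\<rparr>"


section \<open>Banach algebras, bimodules and derivations\<close>

definition banach_algebra ::
  "('k::real_normed_field, 'u::ab_group_add) nspace \<Rightarrow> ('u \<Rightarrow> 'u \<Rightarrow> 'u) \<Rightarrow> bool" where
  "banach_algebra C mul \<longleftrightarrow>
     banach_space C \<and> bounded_bilinear_map C C C mul \<and>
     (\<forall>a\<in>pts C. \<forall>b\<in>pts C. \<forall>c\<in>pts C. mul (mul a b) c = mul a (mul b c)) \<and>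
     (\<forall>a\<in>pts C. \<forall>b\<in>pts C. nrm C (mul a b) \<le> nrm C a * nrm C b)"

text \<open>The module actions are only required to be bounded, not contractive.\<close>

definition banach_bimodule ::
  "('k::real_normed_field, 'c::ab_group_add) nspace \<Rightarrow> ('c \<Rightarrow> 'c \<Rightarrow> 'c)
     \<Rightarrow> ('k, 'x::ab_group_add) nspace \<Rightarrow> ('c \<Rightarrow> 'x \<Rightarrow> 'x) \<Rightarrow> ('x \<Rightarrow> 'c \<Rightarrow> 'x) \<Rightarrow> bool" where
  "banach_bimodule C mul X l r \<longleftrightarrow>
     banach_space X \<and> bounded_bilinear_map C X X l \<and> bounded_bilinear_map X C X r \<and>
     (\<forall>c\<in>pts C. \<forall>d\<in>pts C. \<forall>x\<in>pts X.
        l (mul c d) x = l c (l d x) \<and> r x (mul c d) = r (r x c) d \<and> r (l c x) d = l c (r x d))"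

definition derivation ::
  "('k::real_normed_field, 'c::ab_group_add) nspace \<Rightarrow> ('c \<Rightarrow> 'c \<Rightarrow> 'c)
     \<Rightarrow> ('k, 'x::ab_group_add) nspace \<Rightarrow> ('c \<Rightarrow> 'x \<Rightarrow> 'x) \<Rightarrow> ('x \<Rightarrow> 'c \<Rightarrow> 'x)
     \<Rightarrow> ('c \<Rightarrow> 'x) \<Rightarrow> bool" where
  "derivation C mul X l r D \<longleftrightarrow> bounded_linear_map C X D \<and>
     (\<forall>c\<in>pts C. \<forall>d\<in>pts C. D (mul c d) = r (D c) d + l c (D d))"

definition ad :: "('c \<Rightarrow> 'x::ab_group_add \<Rightarrow> 'x) \<Rightarrow> ('x \<Rightarrow> 'c \<Rightarrow> 'x) \<Rightarrow> 'x \<Rightarrow> 'c \<Rightarrow> 'x" where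
  "ad l r x c = l c x - r x c"

definition bounded_bimodule_map ::
  "('c::ab_group_add) set
     \<Rightarrow> ('k::real_normed_field, 'x::ab_group_add) nspace \<Rightarrow> ('c \<Rightarrow> 'x \<Rightarrow> 'x) \<Rightarrow> ('x \<Rightarrow> 'c \<Rightarrow> 'x)
     \<Rightarrow> ('k, 'y::ab_group_add) nspace \<Rightarrow> ('c \<Rightarrow> 'y \<Rightarrow> 'y) \<Rightarrow> ('y \<Rightarrow> 'c \<Rightarrow> 'y)
     \<Rightarrow> ('x \<Rightarrow> 'y) \<Rightarrow> bool" where
  "bounded_bimodule_map C X lX rX Y lY rY f \<longleftrightarrow> bounded_linear_map X Y f \<and>
     (\<forall>c\<in>C. \<forall>x\<in>pts X. f (lX c x) = lY c (f x) \<and> f (rX x c) = rY (f x) c)"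


section \<open>Iterated duals\<close>

text \<open>
  \<open>Y\<close> is the Banach dual of \<open>X\<close> via the pairing \<open>p\<close>: sending \<open>f\<close> to the functional
  \<open>p f\<close> is a linear bijection of \<open>Y\<close> onto the bounded linear functionals on \<open>X\<close>, and the norm of
  \<open>Y\<close> is the operator norm (which makes the map injective).
\<close>

definition is_dual ::
  "('k::real_normed_field, 'u::ab_group_add) nspace \<Rightarrow> ('k, 'v::ab_group_add) nspace
     \<Rightarrow> ('v \<Rightarrow> 'u \<Rightarrow> 'k) \<Rightarrow> bool" where
  "is_dual X Y p \<longleftrightarrow> normed_space Y \<and>
     (\<forall>f\<in>pts Y. bounded_linear_map X scalars (p f)) \<and>
     (\<forall>f\<in>pts Y. \<forall>g\<in>pts Y. \<forall>x\<in>pts X. p (f + g) x = p f x + p g x) \<and>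
     (\<forall>c. \<forall>f\<in>pts Y. \<forall>x\<in>pts X. p (scale Y c f) x = c * p f x) \<and>
     (\<forall>\<phi>. bounded_linear_map X scalars \<phi> \<longrightarrow> (\<exists>f\<in>pts Y. \<forall>x\<in>pts X. p f x = \<phi> x)) \<and>
     (\<forall>f\<in>pts Y. nrm Y f = (SUP x\<in>{x \<in> pts X. nrm X x \<le> 1}. norm (p f x)))"

text \<open>
  \<open>dlev T k\<close> is the \<open>k\<close>-th dual of \<open>dlev T 0\<close> and \<open>dpair T k f x\<close> is the value of
  \<open>f \<in> dlev T (k + 1)\<close> at \<open>x \<in> dlev T k\<close>. Only finitely many levels can be required, since
  in general no single type has room for the duals of all orders. For each \<open>m\<close> a tower of
  height \<open>m\<close> exists over every normed space, in a type depending on \<open>m\<close>: see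
  \<open>dual_tower_extend\<close> below.
\<close>

record ('k, 'u) dtower =
  dlev :: "nat \<Rightarrow> ('k, 'u) nspace"
  dpair :: "nat \<Rightarrow> 'u \<Rightarrow> 'u \<Rightarrow> 'k"

definition dual_tower :: "nat \<Rightarrow> ('k::real_normed_field, 'u::ab_group_add) dtower \<Rightarrow> bool" where
  "dual_tower m T \<longleftrightarrow> normed_space (dlev T 0) \<and>
     (\<forall>k<m. is_dual (dlev T k) (dlev T (Suc k)) (dpair T k))"

text \<open>The element of the \<open>(k + 1)\<close>-st dual representing the functional \<open>\<phi>\<close> on the \<open>k\<close>-th dual.\<close>

definition dual_rep ::
  "('k::real_normed_field, 'u::ab_group_add) dtower \<Rightarrow> nat \<Rightarrow> ('u \<Rightarrow> 'k) \<Rightarrow> 'u" where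
  "dual_rep T k \<phi> =
     (THE f. f \<in> pts (dlev T (Suc k)) \<and> (\<forall>x\<in>pts (dlev T k). dpair T k f x = \<phi> x))"

fun dual_left ::
  "('k::real_normed_field, 'u::ab_group_add) dtower \<Rightarrow> ('c \<Rightarrow> 'u \<Rightarrow> 'u) \<Rightarrow> ('u \<Rightarrow> 'c \<Rightarrow> 'u)
     \<Rightarrow> nat \<Rightarrow> 'c \<Rightarrow> 'u \<Rightarrow> 'u"
and dual_right ::
  "('k::real_normed_field, 'u::ab_group_add) dtower \<Rightarrow> ('c \<Rightarrow> 'u \<Rightarrow> 'u) \<Rightarrow> ('u \<Rightarrow> 'c \<Rightarrow> 'u)
     \<Rightarrow> nat \<Rightarrow> 'u \<Rightarrow> 'c \<Rightarrow> 'u" where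
  "dual_left T l r 0 c x = l c x"
| "dual_left T l r (Suc k) c f = dual_rep T k (\<lambda>x. dpair T k f (dual_right T l r k x c))"
| "dual_right T l r 0 x c = r x c"
| "dual_right T l r (Suc k) f c = dual_rep T k (\<lambda>x. dpair T k f (dual_left T l r k c x))"


section \<open>Amalgamated duplication\<close>

text \<open>
  \<open>towA\<close> and \<open>towB\<close> hold the iterated duals of the algebras \<open>A\<close> (calligraphic A)
  and \<open>B\<close> (fraktur A), with products \<open>mulA\<close>, \<open>mulB\<close>; \<open>actL\<close> and \<open>actR\<close> are the left and
  right action of \<open>B\<close> on \<open>A\<close>.
\<close>

record ('k, 'u, 'v) dup_data =
  towA :: "('k, 'u) dtower"
  towB :: "('k, 'v) dtower"
  mulA :: "'u \<Rightarrow> 'u \<Rightarrow> 'u"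
  mulB :: "'v \<Rightarrow> 'v \<Rightarrow> 'v"
  actL :: "'v \<Rightarrow> 'u \<Rightarrow> 'u"
  actR :: "'u \<Rightarrow> 'v \<Rightarrow> 'u"

abbreviation levA where "levA S k \<equiv> dlev (towA S) k"
abbreviation levB where "levB S k \<equiv> dlev (towB S) k"

definition compatible_actions ::
  "('k::real_normed_field, 'u::ab_group_add, 'v::ab_group_add) dup_data \<Rightarrow> bool" where
  "compatible_actions S \<longleftrightarrow>
     (\<forall>a\<in>pts (levA S 0). \<forall>b\<in>pts (levA S 0). \<forall>\<beta>\<in>pts (levB S 0).
        actL S \<beta> (mulA S a b) = mulA S (actL S \<beta> a) b \<and>
        actR S (mulA S a b) \<beta> = mulA S a (actR S b \<beta>) \<and>
        mulA S a (actL S \<beta> b) = mulA S (actR S a \<beta>) b)"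

definition dup_mul ::
  "('k::real_normed_field, 'u::ab_group_add, 'v::ab_group_add) dup_data
     \<Rightarrow> 'u \<times> 'v \<Rightarrow> 'u \<times> 'v \<Rightarrow> 'u \<times> 'v" where
  "dup_mul S = (\<lambda>(a, \<beta>) (b, \<gamma>). (mulA S a b + actR S a \<gamma> + actL S \<beta> b, mulB S \<beta> \<gamma>))"

text \<open>
  Under the coordinatewise pairing the dual of a sum norm is a maximum norm and conversely, so
  the norm of the \<open>k\<close>-th dual of the duplication depends on the parity of \<open>k\<close>; the lemma
  \<open>dual_tower_dup\<close> below confirms that these are the iterated duals.
\<close>

definition dup_tower ::
  "('k::real_normed_field, 'u::ab_group_add, 'v::ab_group_add) dup_data
     \<Rightarrow> ('k, 'u \<times> 'v) dtower" where
  "dup_tower S =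
     \<lparr>dlev = (\<lambda>k.
        \<lparr>pts = pts (levA S k) \<times> pts (levB S k),
         scale = (\<lambda>c (x, y). (scale (levA S k) c x, scale (levB S k) c y)),
         nrm = (\<lambda>(x, y). if even k then nrm (levA S k) x + nrm (levB S k) y
                 else max (nrm (levA S k) x) (nrm (levB S k) y))\<rparr>),
      dpair = (\<lambda>k (f, g) (x, y). dpair (towA S) k f x + dpair (towB S) k g y)\<rparr>"

abbreviation levDup where "levDup S k \<equiv> dlev (dup_tower S) k"

text \<open>
  The induced actions: of \<open>A\<close> on the \<open>k\<close>-th dual of \<open>A\<close>, of \<open>B\<close> on the \<open>k\<close>-th dual of \<open>B\<close>,
  of \<open>B\<close> on the \<open>k\<close>-th dual of \<open>A\<close>, and of the duplication on its own \<open>k\<close>-th dual.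
\<close>

abbreviation AA_left where "AA_left S \<equiv> dual_left (towA S) (mulA S) (mulA S)"
abbreviation AA_right where "AA_right S \<equiv> dual_right (towA S) (mulA S) (mulA S)"
abbreviation BB_left where "BB_left S \<equiv> dual_left (towB S) (mulB S) (mulB S)"
abbreviation BB_right where "BB_right S \<equiv> dual_right (towB S) (mulB S) (mulB S)"
abbreviation BA_left where "BA_left S \<equiv> dual_left (towA S) (actL S) (actR S)"
abbreviation BA_right where "BA_right S \<equiv> dual_right (towA S) (actL S) (actR S)"
abbreviation dup_left where "dup_left S \<equiv> dual_left (dup_tower S) (dup_mul S) (dup_mul S)"
abbreviation dup_right where "dup_right S \<equiv> dual_right (dup_tower S) (dup_mul S) (dup_mul S)"

text \<open>
  The mixed operations of \<open>a \<in> A\<close>. The even ones take \<open>y\<close> in the \<open>2m\<close>-th dual of \<open>B\<close> to the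
  \<open>2m\<close>-th dual of \<open>A\<close>; the odd ones take \<open>x\<close> in the \<open>(2m + 1)\<close>-st dual of \<open>A\<close> to the
  \<open>(2m + 1)\<close>-st dual of \<open>B\<close>. The argument is \<open>m\<close>, not the order of the dual.
\<close>

fun mix_left_even :: "('k::real_normed_field, 'u::ab_group_add, 'v::ab_group_add) dup_data
      \<Rightarrow> nat \<Rightarrow> 'u \<Rightarrow> 'v \<Rightarrow> 'u"
and mix_right_even :: "('k::real_normed_field, 'u::ab_group_add, 'v::ab_group_add) dup_data
      \<Rightarrow> nat \<Rightarrow> 'v \<Rightarrow> 'u \<Rightarrow> 'u"
and mix_left_odd :: "('k::real_normed_field, 'u::ab_group_add, 'v::ab_group_add) dup_data
      \<Rightarrow> nat \<Rightarrow> 'u \<Rightarrow> 'u \<Rightarrow> 'v"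
and mix_right_odd :: "('k::real_normed_field, 'u::ab_group_add, 'v::ab_group_add) dup_data
      \<Rightarrow> nat \<Rightarrow> 'u \<Rightarrow> 'u \<Rightarrow> 'v" where
  "mix_left_even S 0 a y = actR S a y"
| "mix_right_even S 0 y a = actL S y a"
| "mix_left_odd S m a x =
     dual_rep (towB S) (2 * m) (\<lambda>y. dpair (towA S) (2 * m) x (mix_right_even S m y a))"
| "mix_right_odd S m x a =
     dual_rep (towB S) (2 * m) (\<lambda>y. dpair (towA S) (2 * m) x (mix_left_even S m a y))"
| "mix_left_even S (Suc m) a y =
     dual_rep (towA S) (2 * m + 1) (\<lambda>x. dpair (towB S) (2 * m + 1) y (mix_right_odd S m x a))"
| "mix_right_even S (Suc m) y a =
     dual_rep (towA S) (2 * m + 1) (\<lambda>x. dpair (towB S) (2 * m + 1) y (mix_left_odd S m a x))"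

text \<open>
  \<open>DA1\<close>, \<open>DA2\<close> are the components of \<open>D\<close> on \<open>A\<close> with values in the \<open>2n\<close>-th dual of \<open>A\<close> and
  of \<open>B\<close>, respectively; \<open>DB1\<close>, \<open>DB2\<close> are those on \<open>B\<close>.
\<close>

definition dup_decomposition ::
  "('k::real_normed_field, 'u::ab_group_add, 'v::ab_group_add) dup_data \<Rightarrow> nat
     \<Rightarrow> ('u \<times> 'v \<Rightarrow> 'u \<times> 'v) \<Rightarrow> ('u \<Rightarrow> 'u) \<Rightarrow> ('u \<Rightarrow> 'v) \<Rightarrow> ('v \<Rightarrow> 'u) \<Rightarrow> ('v \<Rightarrow> 'v) \<Rightarrow> bool" where
  "dup_decomposition S n D DA1 DA2 DB1 DB2 \<longleftrightarrow>
     derivation (levB S 0) (mulB S) (levB S (2*n)) (BB_left S (2*n)) (BB_right S (2*n)) DB2 \<and>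
     derivation (levB S 0) (mulB S) (levA S (2*n)) (BA_left S (2*n)) (BA_right S (2*n)) DB1 \<and>
     bounded_bimodule_map (pts (levB S 0)) (levA S 0) (actL S) (actR S)
       (levB S (2*n)) (BB_left S (2*n)) (BB_right S (2*n)) DA2 \<and>
     bounded_linear_map (levA S 0) (levA S (2*n)) DA1 \<and>
     (\<forall>a\<in>pts (levA S 0). \<forall>b\<in>pts (levA S 0). \<forall>\<beta>\<in>pts (levB S 0).
        D (a, \<beta>) = (DA1 a + DB1 \<beta>, DA2 a + DB2 \<beta>) \<and>
        DA1 (mulA S a b) = AA_right S (2*n) (DA1 a) b + mix_right_even S n (DA2 a) b
                         + AA_left S (2*n) a (DA1 b) + mix_left_even S n a (DA2 b) \<and>
        DA1 (actL S \<beta> a) = AA_right S (2*n) (DB1 \<beta>) a + mix_right_even S n (DB2 \<beta>) a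
                          + BA_left S (2*n) \<beta> (DA1 a) \<and>
        DA1 (actR S a \<beta>) = AA_left S (2*n) a (DB1 \<beta>) + mix_left_even S n a (DB2 \<beta>)
                          + BA_right S (2*n) (DA1 a) \<beta> \<and>
        DA2 (mulA S a b) = 0)"


section \<open>The towers used above are towers of duals, and towers exist\<close>

lemma nspD:
  assumes "normed_space X"
  shows "vector_space (scale X)" "module (scale X)" "module.subspace (scale X) (pts X)" "0 \<in> pts X"
    "x \<in> pts X \<Longrightarrow> y \<in> pts X \<Longrightarrow> x + y \<in> pts X"
    "x \<in> pts X \<Longrightarrow> scale X c x \<in> pts X"
    "x \<in> pts X \<Longrightarrow> 0 \<le> nrm X x" "nrm X 0 = 0"
    "x \<in> pts X \<Longrightarrow> nrm X x = 0 \<Longrightarrow> x = 0"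
    "x \<in> pts X \<Longrightarrow> nrm X (scale X c x) = norm c * nrm X x"
    "x \<in> pts X \<Longrightarrow> y \<in> pts X \<Longrightarrow> nrm X (x + y) \<le> nrm X x + nrm X y"
proof -
  show 1: "vector_space (scale X)" using assms by (simp add: normed_space_def)
  show 2: "module (scale X)" using 1 by (simp add: module_iff_vector_space)
  show s: "module.subspace (scale X) (pts X)" using assms by (simp add: normed_space_def)
  show 3: "0 \<in> pts X" using module.subspace_0[OF 2 s] .
  show "x \<in> pts X \<Longrightarrow> y \<in> pts X \<Longrightarrow> x + y \<in> pts X" using module.subspace_add[OF 2 s] .
  show "x \<in> pts X \<Longrightarrow> scale X c x \<in> pts X" using module.subspace_scale[OF 2 s] .
qed (use assms in \<open>auto simp: normed_space_def module.subspace_def module_iff_vector_space\<close>)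

lemma scalars_sel [simp]: "pts scalars = UNIV" "scale scalars = (*)" "nrm scalars = norm"
  by (simp_all add: scalars_def)

lemma blm_bound:
  assumes X: "normed_space X" and f: "bounded_linear_map X scalars \<phi>"
  defines "S \<equiv> (SUP x\<in>{x \<in> pts X. nrm X x \<le> 1}. norm (\<phi> x))"
  shows "x \<in> pts X \<Longrightarrow> norm (\<phi> x) \<le> S * nrm X x" "0 \<le> S"
    "(\<And>x. x \<in> pts X \<Longrightarrow> nrm X x \<le> 1 \<Longrightarrow> norm (\<phi> x) \<le> M) \<Longrightarrow> S \<le> M"
    "x \<in> pts X \<Longrightarrow> nrm X x \<le> 1 \<Longrightarrow> norm (\<phi> x) \<le> S"
proof -
  let ?B = "{x \<in> pts X. nrm X x \<le> 1}"
  obtain K where K: "\<And>x. x \<in> pts X \<Longrightarrow> norm (\<phi> x) \<le> K * nrm X x"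
    using f unfolding bounded_linear_map_def scalars_sel by blast
  have ne: "0 \<in> ?B" using nspD[OF X] by simp
  have bdd: "bdd_above ((\<lambda>x. norm (\<phi> x)) ` ?B)"
  proof (rule bdd_aboveI2)
    fix x assume x: "x \<in> ?B"
    have "norm (\<phi> x) \<le> K * nrm X x" using K x by simp
    also have "\<dots> \<le> \<bar>K\<bar> * 1"
      by (rule mult_mono) (use x nspD(7)[OF X] in auto)
    finally show "norm (\<phi> x) \<le> \<bar>K\<bar>" by simp
  qed
  have up: "norm (\<phi> x) \<le> S" if "x \<in> pts X" "nrm X x \<le> 1" for x
    unfolding S_def by (rule cSUP_upper[OF _ bdd]) (use that in auto)
  then show "x \<in> pts X \<Longrightarrow> nrm X x \<le> 1 \<Longrightarrow> norm (\<phi> x) \<le> S" .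
  show S0: "0 \<le> S" using up[of 0] ne norm_ge_zero[of "\<phi> 0"] by (simp, linarith)
  show "S \<le> M" if "\<And>x. x \<in> pts X \<Longrightarrow> nrm X x \<le> 1 \<Longrightarrow> norm (\<phi> x) \<le> M"
    unfolding S_def by (rule cSUP_least) (use ne that in auto)
  show "norm (\<phi> x) \<le> S * nrm X x" if x: "x \<in> pts X"
  proof (cases "nrm X x = 0")
    case True
    then show ?thesis using K[OF x] by simp
  next
    case False
    then have p: "nrm X x > 0" using nspD(7)[OF X x] by simp
    define c :: 'a where "c = of_real (1 / nrm X x)"
    have nc: "norm c = 1 / nrm X x" using p by (simp add: c_def norm_divide)
    have "norm (\<phi> (scale X c x)) \<le> S"
      by (rule up) (use nspD(6,10)[OF X x] nc p in auto)
    moreover have "\<phi> (scale X c x) = c * \<phi> x"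
      using f x by (simp add: bounded_linear_map_def)
    ultimately have "norm (\<phi> x) / nrm X x \<le> S" by (simp add: norm_mult nc)
    then show ?thesis using p by (simp add: field_simps)
  qed
qed

lemma blm0:
  assumes "normed_space X" "bounded_linear_map X Y \<phi>"
  shows "\<phi> 0 = 0"
proof -
  have "\<phi> (0 + 0) = \<phi> 0 + \<phi> 0"
    using assms nspD(4)[OF assms(1)] unfolding bounded_linear_map_def by blast
  then show ?thesis by simp
qed

lemma dual_bound:
  assumes X: "normed_space X" and d: "is_dual X Y p" and f: "f \<in> pts Y"
  shows "x \<in> pts X \<Longrightarrow> norm (p f x) \<le> nrm Y f * nrm X x"
    "(\<And>x. x \<in> pts X \<Longrightarrow> nrm X x \<le> 1 \<Longrightarrow> norm (p f x) \<le> M) \<Longrightarrow> nrm Y f \<le> M"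
proof -
  have b: "bounded_linear_map X scalars (p f)"
    and n: "nrm Y f = (SUP x\<in>{x \<in> pts X. nrm X x \<le> 1}. norm (p f x))"
    using d f by (auto simp: is_dual_def)
  show "x \<in> pts X \<Longrightarrow> norm (p f x) \<le> nrm Y f * nrm X x"
    "(\<And>x. x \<in> pts X \<Longrightarrow> nrm X x \<le> 1 \<Longrightarrow> norm (p f x) \<le> M) \<Longrightarrow> nrm Y f \<le> M"
    unfolding n by (fact blm_bound[OF X b])+
qed

text \<open>The product with the sum norm (\<open>e\<close> true) or the maximum norm (\<open>e\<close> false).\<close>

definition nprod where
  "nprod e X Y = \<lparr>pts = pts X \<times> pts Y,
     scale = (\<lambda>c (x, y). (scale X c x, scale Y c y)),
     nrm = (\<lambda>(x, y). if e then nrm X x + nrm Y y else max (nrm X x) (nrm Y y))\<rparr>"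

lemma nprod_normed:
  assumes X: "normed_space X" and Y: "normed_space Y"
  shows "normed_space (nprod e X Y)"
proof -
  have m: "vector_space (\<lambda>c (x, y). (scale X c x, scale Y c y))"
    using nspD(1)[OF X] nspD(1)[OF Y]
    by (auto simp: vector_space_def split: prod.splits)
  then have mm: "module (\<lambda>c (x, y). (scale X c x, scale Y c y))"
    by (simp add: module_iff_vector_space)
  note D = nspD[OF X] nspD[OF Y]
  show ?thesis unfolding normed_space_def
  proof (intro conjI)
    show "vector_space (scale (nprod e X Y))" using m by (simp add: nprod_def)
    show "module.subspace (scale (nprod e X Y)) (pts (nprod e X Y))"
      using D by (auto simp: nprod_def module.subspace_def[OF mm] zero_prod_def)
    show "\<forall>x\<in>pts (nprod e X Y). 0 \<le> nrm (nprod e X Y) x \<and> (nrm (nprod e X Y) x = 0) = (x = 0)"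
    proof (safe)
      fix a b assume ab: "(a,b) \<in> pts (nprod e X Y)"
      then have a: "a \<in> pts X" and b: "b \<in> pts Y" by (auto simp: nprod_def)
      have n: "0 \<le> nrm X a" "0 \<le> nrm Y b" using D a b by auto
      then show "0 \<le> nrm (nprod e X Y) (a,b)" by (auto simp: nprod_def)
      assume "nrm (nprod e X Y) (a, b) = 0"
      then have "nrm X a = 0" "nrm Y b = 0" using n by (auto simp: nprod_def split: if_splits)
      then show "(a,b) = 0" using D a b by (auto simp: zero_prod_def)
    qed (use D in \<open>auto simp: nprod_def zero_prod_def\<close>)
    show "\<forall>c. \<forall>x\<in>pts (nprod e X Y). nrm (nprod e X Y) (scale (nprod e X Y) c x) = norm c * nrm (nprod e X Y) x"
      using D by (auto simp: nprod_def distrib_left max_mult_distrib_left)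
    show "\<forall>x\<in>pts (nprod e X Y). \<forall>y\<in>pts (nprod e X Y). nrm (nprod e X Y) (x + y) \<le> nrm (nprod e X Y) x + nrm (nprod e X Y) y"
    proof safe
      fix a b a' b' assume "(a,b) \<in> pts (nprod e X Y)" "(a',b') \<in> pts (nprod e X Y)"
      then have "nrm X (a + a') \<le> nrm X a + nrm X a'" "nrm Y (b + b') \<le> nrm Y b + nrm Y b'"
        using D by (auto simp: nprod_def)
      then show "nrm (nprod e X Y) ((a, b) + (a', b')) \<le> nrm (nprod e X Y) (a, b) + nrm (nprod e X Y) (a', b')"
        by (auto simp: nprod_def max_def)
    qed
  qed
qed

lemma unit_rot: "\<exists>c::'k::real_normed_field. norm c = 1 \<and> c * z = of_real (norm z)"
proof (cases "z = 0")
  case True then show ?thesis by (intro exI[of _ 1]) simp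
next
  case False then show ?thesis by (intro exI[of _ "of_real (norm z) / z"]) (simp add: norm_divide)
qed

lemma is_dual_nprod:
  assumes X: "normed_space X" and Y: "normed_space Y"
    and dX: "is_dual X X' p" and dY: "is_dual Y Y' q"
  shows "is_dual (nprod e X Y) (nprod (\<not> e) X' Y') (\<lambda>(f, g) (x, y). p f x + q g y)"
    (is "is_dual ?Z ?Z' ?r")
proof -
  have X': "normed_space X'" and Y': "normed_space Y'" using dX dY by (auto simp: is_dual_def)
  have Z: "normed_space ?Z" using X Y by (rule nprod_normed)
  have Z': "normed_space ?Z'" using X' Y' by (rule nprod_normed)
  have pl: "bounded_linear_map X scalars (p f)" if "f \<in> pts X'" for f
    using dX that by (auto simp: is_dual_def)
  have ql: "bounded_linear_map Y scalars (q f)" if "f \<in> pts Y'" for f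
    using dY that by (auto simp: is_dual_def)
  have pn: "nrm X' f = (SUP x\<in>{x \<in> pts X. nrm X x \<le> 1}. norm (p f x))" if "f \<in> pts X'" for f
    using dX that by (auto simp: is_dual_def)
  have qn: "nrm Y' f = (SUP x\<in>{x \<in> pts Y. nrm Y x \<le> 1}. norm (q f x))" if "f \<in> pts Y'" for f
    using dY that by (auto simp: is_dual_def)
  note pb = dual_bound[OF X dX] and qb = dual_bound[OF Y dY]
  note D = nspD[OF X] nspD[OF Y]
  have bl: "bounded_linear_map ?Z scalars (?r (f, g))" if f: "f \<in> pts X'" and g: "g \<in> pts Y'" for f g
    unfolding bounded_linear_map_def
  proof (intro conjI)
    show "\<forall>x\<in>pts ?Z. \<forall>y\<in>pts ?Z. ?r (f, g) (x + y) = ?r (f, g) x + ?r (f, g) y"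
      using pl[OF f] ql[OF g] by (auto simp: nprod_def bounded_linear_map_def)
    show "\<forall>c. \<forall>x\<in>pts ?Z. ?r (f, g) (scale ?Z c x) = scale scalars c (?r (f, g) x)"
      using pl[OF f] ql[OF g] by (auto simp: nprod_def bounded_linear_map_def distrib_left)
    show "\<exists>K. \<forall>x\<in>pts ?Z. nrm scalars (?r (f, g) x) \<le> K * nrm ?Z x"
    proof (intro exI[of _ "nrm X' f + nrm Y' g"] ballI, clarify)
      fix x y assume "(x, y) \<in> pts ?Z"
      then have x: "x \<in> pts X" and y: "y \<in> pts Y" by (auto simp: nprod_def)
      have n: "0 \<le> nrm X x" "0 \<le> nrm Y y" "0 \<le> nrm X' f" "0 \<le> nrm Y' g"
        using D x y f g nspD(7)[OF X'] nspD(7)[OF Y'] by auto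
      then have "nrm X x \<le> nrm ?Z (x,y)" "nrm Y y \<le> nrm ?Z (x,y)" by (auto simp: nprod_def)
      moreover have "norm (p f x + q g y) \<le> nrm X' f * nrm X x + nrm Y' g * nrm Y y"
        using pb(1)[OF f x] qb(1)[OF g y] norm_triangle_ineq[of "p f x" "q g y"] by linarith
      ultimately have "norm (p f x + q g y) \<le> nrm X' f * nrm ?Z (x,y) + nrm Y' g * nrm ?Z (x,y)"
        using n by (meson add_mono mult_left_mono order_trans)
      then show "nrm scalars (p f x + q g y) \<le> (nrm X' f + nrm Y' g) * nrm ?Z (x,y)"
        by (simp add: distrib_right)
    qed
  qed simp
  show ?thesis unfolding is_dual_def
  proof (intro conjI)
    show "normed_space ?Z'" by (rule Z')
    show "\<forall>f\<in>pts ?Z'. bounded_linear_map ?Z scalars (?r f)"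
      using bl by (auto simp: nprod_def)
    show "\<forall>f\<in>pts ?Z'. \<forall>g\<in>pts ?Z'. \<forall>x\<in>pts ?Z. ?r (f + g) x = ?r f x + ?r g x"
      using dX dY by (auto simp: nprod_def is_dual_def)
    show "\<forall>c. \<forall>f\<in>pts ?Z'. \<forall>x\<in>pts ?Z. ?r (scale ?Z' c f) x = c * ?r f x"
      using dX dY by (auto simp: nprod_def is_dual_def distrib_left)
    show "\<forall>\<phi>. bounded_linear_map ?Z scalars \<phi> \<longrightarrow> (\<exists>f\<in>pts ?Z'. \<forall>x\<in>pts ?Z. ?r f x = \<phi> x)"
    proof (intro allI impI)
      fix \<phi> assume \<phi>: "bounded_linear_map ?Z scalars \<phi>"
      have add: "\<And>x x' y y'. x \<in> pts X \<Longrightarrow> x' \<in> pts X \<Longrightarrow> y \<in> pts Y \<Longrightarrow> y' \<in> pts Y \<Longrightarrow>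
          \<phi> (x + x', y + y') = \<phi> (x, y) + \<phi> (x', y')"
        using \<phi> by (auto simp: nprod_def bounded_linear_map_def)
      have sc: "\<And>c x y. x \<in> pts X \<Longrightarrow> y \<in> pts Y \<Longrightarrow> \<phi> (scale X c x, scale Y c y) = c * \<phi> (x, y)"
        using \<phi> by (auto simp: nprod_def bounded_linear_map_def)
      obtain K where K0: "\<forall>z\<in>pts ?Z. norm (\<phi> z) \<le> K * nrm ?Z z"
        using \<phi> unfolding bounded_linear_map_def scalars_sel by blast
      have K: "norm (\<phi> (x, y)) \<le> K * nrm ?Z (x, y)" if "x \<in> pts X" "y \<in> pts Y" for x y
        using K0 that by (auto simp: nprod_def)
      have s0: "scale X c 0 = 0" "scale Y c 0 = 0" for c
        using module.scale_zero_right[OF nspD(2)[OF X]] module.scale_zero_right[OF nspD(2)[OF Y]] by auto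
      have "bounded_linear_map X scalars (\<lambda>x. \<phi> (x, 0))"
        unfolding bounded_linear_map_def
      proof (intro conjI)
        show "\<exists>K. \<forall>x\<in>pts X. nrm scalars (\<phi> (x, 0)) \<le> K * nrm X x"
        proof (intro exI[of _ K] ballI)
          fix x assume x: "x \<in> pts X"
          have "nrm ?Z (x, 0) = nrm X x"
            using nspD(7)[OF X x] nspD(8)[OF Y] by (simp add: nprod_def)
          then show "nrm scalars (\<phi> (x, 0)) \<le> K * nrm X x"
            using K[OF x nspD(4)[OF Y]] by simp
        qed
      qed (use add[of _ _ 0 0] sc[of _ 0] s0 D in auto)
      then obtain f where f: "f \<in> pts X'" "\<forall>x\<in>pts X. p f x = \<phi> (x, 0)"
        using dX unfolding is_dual_def by meson
      have "bounded_linear_map Y scalars (\<lambda>x. \<phi> (0, x))"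
        unfolding bounded_linear_map_def
      proof (intro conjI)
        show "\<exists>K. \<forall>x\<in>pts Y. nrm scalars (\<phi> (0, x)) \<le> K * nrm Y x"
        proof (intro exI[of _ K] ballI)
          fix y assume y: "y \<in> pts Y"
          have "nrm ?Z (0, y) = nrm Y y"
            using nspD(7)[OF Y y] nspD(8)[OF X] by (simp add: nprod_def)
          then show "nrm scalars (\<phi> (0, y)) \<le> K * nrm Y y"
            using K[OF nspD(4)[OF X] y] by simp
        qed
      qed (use add[of 0 0] sc[of 0] s0 D in auto)
      then obtain g where g: "g \<in> pts Y'" "\<forall>x\<in>pts Y. q g x = \<phi> (0, x)"
        using dY unfolding is_dual_def by meson
      have "?r (f, g) z = \<phi> z" if "z \<in> pts ?Z" for z
        using that f g add[of "fst z" 0 0 "snd z"] D by (auto simp: nprod_def)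
      then show "\<exists>f\<in>pts ?Z'. \<forall>x\<in>pts ?Z. ?r f x = \<phi> x"
        using f g by (intro bexI[of _ "(f, g)"]) (auto simp: nprod_def)
    qed
    show "\<forall>h\<in>pts ?Z'. nrm ?Z' h = (SUP x\<in>{x \<in> pts ?Z. nrm ?Z x \<le> 1}. norm (?r h x))"
    proof clarify
      fix f g assume "(f, g) \<in> pts ?Z'"
      then have f: "f \<in> pts X'" and g: "g \<in> pts Y'" by (auto simp: nprod_def)
      define S where "S = (SUP x\<in>{x \<in> pts ?Z. nrm ?Z x \<le> 1}. norm (?r (f, g) x))"
      note rb = blm_bound[OF Z bl[OF f g], folded S_def]
      have n': "0 \<le> nrm X' f" "0 \<le> nrm Y' g"
        using nspD(7)[OF X'] nspD(7)[OF Y'] f g by auto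
      have p0: "p f 0 = 0" "q g 0 = 0" using blm0[OF X pl[OF f]] blm0[OF Y ql[OF g]] by auto
      have "nrm ?Z' (f, g) \<le> S"
      proof (cases e)
        case True
        have "nrm X' f \<le> S"
        proof (rule pb(2)[OF f])
          fix x assume x: "x \<in> pts X" "nrm X x \<le> 1"
          show "norm (p f x) \<le> S" using rb(4)[of "(x, 0)"] x True D p0 by (auto simp: nprod_def)
        qed
        moreover have "nrm Y' g \<le> S"
        proof (rule qb(2)[OF g])
          fix x assume x: "x \<in> pts Y" "nrm Y x \<le> 1"
          show "norm (q g x) \<le> S" using rb(4)[of "(0, x)"] x True D p0 by (auto simp: nprod_def)
        qed
        ultimately show ?thesis using True by (simp add: nprod_def)
      next
        case False
        have *: "norm (p f x) + norm (q g y) \<le> S"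
          if x: "x \<in> pts X" "nrm X x \<le> 1" and y: "y \<in> pts Y" "nrm Y y \<le> 1" for x y
        proof -
          obtain c where c: "norm c = 1" "c * p f x = of_real (norm (p f x))" using unit_rot by blast
          obtain d where d: "norm d = 1" "d * q g y = of_real (norm (q g y))" using unit_rot by blast
          have "norm (p f (scale X c x) + q g (scale Y d y)) \<le> S"
            using rb(4)[of "(scale X c x, scale Y d y)"] x y c d D False by (auto simp: nprod_def)
          moreover have "p f (scale X c x) = c * p f x" "q g (scale Y d y) = d * q g y"
            using pl[OF f] ql[OF g] x y by (auto simp: bounded_linear_map_def)
          ultimately have "norm (of_real (norm (p f x) + norm (q g y)) :: 'a) \<le> S"
            using c d by simp
          then show ?thesis by (simp only: norm_of_real)
        qed
        have "nrm X' f \<le> S - nrm Y' g"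
        proof (rule pb(2)[OF f])
          fix x assume x: "x \<in> pts X" "nrm X x \<le> 1"
          have "nrm Y' g \<le> S - norm (p f x)"
          proof (rule qb(2)[OF g])
            fix y assume "y \<in> pts Y" "nrm Y y \<le> 1"
            then show "norm (q g y) \<le> S - norm (p f x)" using *[OF x, of y] by simp
          qed
          then show "norm (p f x) \<le> S - nrm Y' g" by simp
        qed
        then show ?thesis using False by (simp add: nprod_def)
      qed
      moreover have "S \<le> nrm ?Z' (f, g)"
      proof (rule rb(3), clarify)
        fix x y assume xy: "(x, y) \<in> pts ?Z" "nrm ?Z (x, y) \<le> 1"
        then have x: "x \<in> pts X" and y: "y \<in> pts Y" by (auto simp: nprod_def)
        have n: "0 \<le> nrm X x" "0 \<le> nrm Y y" using D x y by auto
        have "norm (p f x + q g y) \<le> nrm X' f * nrm X x + nrm Y' g * nrm Y y"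
          using pb(1)[OF f x] qb(1)[OF g y] norm_triangle_ineq[of "p f x" "q g y"] by linarith
        also have "\<dots> \<le> nrm ?Z' (f, g)"
        proof (cases e)
          case True
          let ?m = "max (nrm X' f) (nrm Y' g)"
          have "nrm X' f * nrm X x + nrm Y' g * nrm Y y \<le> ?m * nrm X x + ?m * nrm Y y"
            using n by (intro add_mono mult_right_mono) auto
          also have "\<dots> = ?m * (nrm X x + nrm Y y)" by (simp add: distrib_left)
          also have "\<dots> \<le> ?m * 1"
            using xy True n' by (intro mult_left_mono) (auto simp: nprod_def)
          finally show ?thesis using True by (simp add: nprod_def)
        next
          case False
          then have "nrm X x \<le> 1" "nrm Y y \<le> 1" using xy by (auto simp: nprod_def)
          then have "nrm X' f * nrm X x + nrm Y' g * nrm Y y \<le> nrm X' f * 1 + nrm Y' g * 1"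
            using n' by (intro add_mono mult_left_mono) auto
          then show ?thesis using False by (simp add: nprod_def)
        qed
        finally show "norm (p f x + q g y) \<le> nrm ?Z' (f, g)" .
      qed
      ultimately show "nrm ?Z' (f, g) = (SUP x\<in>{x \<in> pts ?Z. nrm ?Z x \<le> 1}.
          norm ((\<lambda>(x, y). p f x + q g y) x))"
        by (simp add: S_def)
    qed
  qed
qed

lemma dual_tower_normed: "dual_tower m T \<Longrightarrow> k \<le> m \<Longrightarrow> normed_space (dlev T k)"
  by (cases k) (auto simp: dual_tower_def is_dual_def)

lemma dual_tower_dup:
  assumes "dual_tower m (towA S)" "dual_tower m (towB S)"
  shows "dual_tower m (dup_tower S)"
proof -
  have l: "dlev (dup_tower S) k = nprod (even k) (dlev (towA S) k) (dlev (towB S) k)" for k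
    by (simp add: dup_tower_def nprod_def)
  have p: "dpair (dup_tower S) k = (\<lambda>(f, g) (x, y). dpair (towA S) k f x + dpair (towB S) k g y)" for k
    by (simp add: dup_tower_def)
  have n: "normed_space (dlev (towA S) k)" "normed_space (dlev (towB S) k)" if "k \<le> m" for k
    using dual_tower_normed[OF assms(1) that] dual_tower_normed[OF assms(2) that] by auto
  show ?thesis
    unfolding dual_tower_def l p even_Suc
  proof (intro conjI allI impI)
    show "normed_space (nprod (even 0) (levA S 0) (levB S 0))"
      by (rule nprod_normed) (use n in auto)
    fix k assume k: "k < m"
    show "is_dual (nprod (even k) (levA S k) (levB S k))
       (nprod (odd k) (levA S (Suc k)) (levB S (Suc k)))
       (\<lambda>(f, g) (x, y). dpair (towA S) k f x + dpair (towB S) k g y)"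
      by (rule is_dual_nprod) (use n k assms in \<open>auto simp: dual_tower_def\<close>)
  qed
qed

text \<open>
  A tower over \<open>'u\<close> is embedded in \<open>'u \<times> ('u \<Rightarrow> 'k)\<close> by the first component, which leaves
  room for the functionals on its last level in the second.
\<close>

definition emb :: "('k::real_normed_field, 'u::ab_group_add) nspace \<Rightarrow> ('k, 'u \<times> ('u \<Rightarrow> 'k)) nspace" where
  "emb X = \<lparr>pts = pts X \<times> {0}, scale = (\<lambda>c (x, \<phi>). (scale X c x, \<lambda>u. c * \<phi> u)),
     nrm = (\<lambda>(x, \<phi>). nrm X x)\<rparr>"

definition fdual :: "('k::real_normed_field, 'u::ab_group_add) nspace \<Rightarrow> ('k, 'u \<times> ('u \<Rightarrow> 'k)) nspace" where
  "fdual X = \<lparr>pts = {0} \<times> {\<phi>. bounded_linear_map X scalars \<phi> \<and> (\<forall>u. u \<notin> pts X \<longrightarrow> \<phi> u = 0)},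
     scale = (\<lambda>c (x, \<phi>). (scale X c x, \<lambda>u. c * \<phi> u)),
     nrm = (\<lambda>(x, \<phi>). SUP x\<in>{x \<in> pts X. nrm X x \<le> 1}. norm (\<phi> x))\<rparr>"

lemma scale_ext:
  assumes X: "normed_space X"
  shows "vector_space (\<lambda>c (x, \<phi>). (scale X c x, \<lambda>u. c * \<phi> u))"
  using nspD(1)[OF X] by (auto simp: vector_space_def fun_eq_iff algebra_simps split: prod.splits)

lemma emb_normed:
  assumes X: "normed_space X" shows "normed_space (emb X)"
  using scale_ext[OF X] nspD[OF X]
  by (auto simp: normed_space_def emb_def module.subspace_def module_iff_vector_space zero_prod_def
      zero_fun_def fun_eq_iff)

lemma blm_add:
  assumes "normed_space X" "bounded_linear_map X scalars f" "bounded_linear_map X scalars g"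
  shows "bounded_linear_map X scalars (f + g)"
  unfolding bounded_linear_map_def
proof (intro conjI)
  show "\<exists>K. \<forall>x\<in>pts X. nrm scalars ((f + g) x) \<le> K * nrm X x"
  proof -
    obtain K where K: "\<And>x. x \<in> pts X \<Longrightarrow> norm (f x) \<le> K * nrm X x"
      using assms(2) unfolding bounded_linear_map_def scalars_sel by blast
    obtain L where L: "\<And>x. x \<in> pts X \<Longrightarrow> norm (g x) \<le> L * nrm X x"
      using assms(3) unfolding bounded_linear_map_def scalars_sel by blast
    have "norm (f x + g x) \<le> (K + L) * nrm X x" if "x \<in> pts X" for x
      using K[OF that] L[OF that] norm_triangle_ineq[of "f x" "g x"] by (simp add: distrib_right)
    then show ?thesis by auto
  qed
qed (use assms in \<open>auto simp: bounded_linear_map_def algebra_simps\<close>)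

lemma blm_scale:
  assumes "bounded_linear_map X scalars f"
  shows "bounded_linear_map X scalars (\<lambda>u. c * f u)"
  unfolding bounded_linear_map_def
proof (intro conjI)
  obtain K where K: "\<And>x. x \<in> pts X \<Longrightarrow> norm (f x) \<le> K * nrm X x"
    using assms unfolding bounded_linear_map_def scalars_sel by blast
  have "norm (c * f x) \<le> (norm c * K) * nrm X x" if "x \<in> pts X" for x
    using mult_left_mono[OF K[OF that], of "norm c"] by (simp add: norm_mult mult.assoc)
  then show "\<exists>K. \<forall>x\<in>pts X. nrm scalars (c * f x) \<le> K * nrm X x" by auto
qed (use assms in \<open>auto simp: bounded_linear_map_def algebra_simps\<close>)

lemma fdual_normed:
  assumes X: "normed_space X" shows "normed_space (fdual X)"
proof -
  let ?F = "{\<phi>. bounded_linear_map X scalars \<phi> \<and> (\<forall>u. u \<notin> pts X \<longrightarrow> \<phi> u = 0)}"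
  let ?N = "\<lambda>\<phi>. SUP x\<in>{x \<in> pts X. nrm X x \<le> 1}. norm (\<phi> x)"
  have m: "module (\<lambda>c (x, \<phi>). (scale X c x, \<lambda>u. c * \<phi> u))"
    using scale_ext[OF X] by (simp add: module_iff_vector_space)
  have s0: "scale X c 0 = 0" for c using module.scale_zero_right[OF nspD(2)[OF X]] .
  have z: "bounded_linear_map X scalars 0"
    by (auto simp: bounded_linear_map_def intro: exI[of _ 0])
  have N0: "?N 0 = 0" using nspD(4,8)[OF X] by (subst cSUP_const[symmetric]) (auto intro!: exI[of _ 0])
  have pos: "\<phi> = 0" if "\<phi> \<in> ?F" "?N \<phi> = 0" for \<phi>
  proof
    fix u show "\<phi> u = 0 u"
      using blm_bound(1)[OF X, of \<phi> u] that by (cases "u \<in> pts X") auto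
  qed
  have tri: "?N (f + g) \<le> ?N f + ?N g" if f: "f \<in> ?F" and g: "g \<in> ?F" for f g
  proof (rule blm_bound(3)[OF X])
    show "bounded_linear_map X scalars (f + g)" using blm_add[OF X] f g by auto
    fix x assume x: "x \<in> pts X" "nrm X x \<le> 1"
    have "norm (f x) \<le> ?N f" "norm (g x) \<le> ?N g"
      using blm_bound(4)[OF X _ x] f g by auto
    then show "norm ((f + g) x) \<le> ?N f + ?N g"
      using norm_triangle_ineq[of "f x" "g x"] by simp
  qed
  have le: "?N (\<lambda>u. c * f u) \<le> norm c * ?N f" if f: "f \<in> ?F" for c f
  proof (rule blm_bound(3)[OF X])
    show "bounded_linear_map X scalars (\<lambda>u. c * f u)" using blm_scale f by auto
    fix x assume x: "x \<in> pts X" "nrm X x \<le> 1"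
    show "norm (c * f x) \<le> norm c * ?N f"
      using mult_left_mono[OF blm_bound(4)[OF X _ x, of f], of "norm c"] f by (auto simp: norm_mult)
  qed
  have hom: "?N (\<lambda>u. c * f u) = norm c * ?N f" if f: "f \<in> ?F" for c f
  proof (cases "c = 0")
    case True
    then show ?thesis using N0 by (simp add: zero_fun_def)
  next
    case False
    have "(\<lambda>u. c * f u) \<in> ?F" using blm_scale f by auto
    from le[OF this, of "inverse c"] have "?N f \<le> inverse (norm c) * ?N (\<lambda>u. c * f u)"
      using False by (simp add: norm_inverse mult.assoc[symmetric])
    then have "norm c * ?N f \<le> norm c * (inverse (norm c) * ?N (\<lambda>u. c * f u))"
      by (rule mult_left_mono) simp
    then have "norm c * ?N f \<le> ?N (\<lambda>u. c * f u)"
      using False by (simp add: mult.assoc[symmetric])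
    then show ?thesis using le[OF f, of c] by linarith
  qed
  show ?thesis unfolding normed_space_def
  proof (intro conjI)
    show "vector_space (scale (fdual X))" using scale_ext[OF X] by (simp add: fdual_def)
    show "module.subspace (scale (fdual X)) (pts (fdual X))"
      using z blm_add[OF X] blm_scale s0
      by (auto simp: fdual_def module.subspace_def[OF m] zero_prod_def)
    show "\<forall>x\<in>pts (fdual X). 0 \<le> nrm (fdual X) x \<and> (nrm (fdual X) x = 0) = (x = 0)"
    proof safe
      fix x \<phi> assume a: "(x, \<phi>) \<in> pts (fdual X)"
      then have \<phi>: "x = 0" "\<phi> \<in> ?F" by (auto simp: fdual_def)
      show "0 \<le> nrm (fdual X) (x, \<phi>)" using blm_bound(2)[OF X] \<phi> by (auto simp: fdual_def)
      assume "nrm (fdual X) (x, \<phi>) = 0"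
      then show "(x, \<phi>) = 0" using pos[OF \<phi>(2)] \<phi>(1) by (simp add: fdual_def zero_prod_def)
    qed (use N0 in \<open>simp add: fdual_def zero_prod_def\<close>)
    show "\<forall>c. \<forall>x\<in>pts (fdual X). nrm (fdual X) (scale (fdual X) c x) = norm c * nrm (fdual X) x"
      using hom by (auto simp: fdual_def)
    show "\<forall>x\<in>pts (fdual X). \<forall>y\<in>pts (fdual X). nrm (fdual X) (x + y) \<le> nrm (fdual X) x + nrm (fdual X) y"
      using tri by (auto simp: fdual_def plus_fun_def)
  qed
qed

lemma emb_blm: "bounded_linear_map (emb X) scalars (\<lambda>(x, u). f x) = bounded_linear_map X scalars f"
  by (simp add: bounded_linear_map_def emb_def)

lemma is_dual_fdual:
  assumes X: "normed_space X"
  shows "is_dual (emb X) (fdual X) (\<lambda>(_, \<phi>) (x, _). \<phi> x)"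
  unfolding is_dual_def
proof (intro conjI)
  show "normed_space (fdual X)" using fdual_normed[OF X] .
  show "\<forall>f\<in>pts (fdual X). bounded_linear_map (emb X) scalars ((\<lambda>(_, \<phi>) (x, _). \<phi> x) f)"
    by (auto simp: fdual_def emb_blm)
  show "\<forall>\<phi>. bounded_linear_map (emb X) scalars \<phi> \<longrightarrow>
        (\<exists>f\<in>pts (fdual X). \<forall>x\<in>pts (emb X). (\<lambda>(_, \<phi>) (x, _). \<phi> x) f x = \<phi> x)"
  proof (intro allI impI)
    fix \<phi> :: "'b \<times> ('b \<Rightarrow> 'a) \<Rightarrow> 'a" assume \<phi>: "bounded_linear_map (emb X) scalars \<phi>"
    define f where "f = (\<lambda>x. if x \<in> pts X then \<phi> (x, 0) else 0)"
    have "bounded_linear_map X scalars f"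
      using \<phi> nspD(5,6)[OF X]
      by (auto simp: bounded_linear_map_def f_def emb_def zero_fun_def plus_fun_def)
    then have "(0, f) \<in> pts (fdual X)" by (auto simp: fdual_def f_def)
    then show "\<exists>f\<in>pts (fdual X). \<forall>x\<in>pts (emb X). (\<lambda>(_, \<phi>) (x, _). \<phi> x) f x = \<phi> x"
      by (rule bexI[rotated]) (auto simp: emb_def f_def)
  qed
  show "\<forall>f\<in>pts (fdual X). nrm (fdual X) f =
       (SUP x\<in>{x \<in> pts (emb X). nrm (emb X) x \<le> 1}. norm ((\<lambda>(_, \<phi>) (x, _). \<phi> x) f x))"
  proof clarify
    fix a \<phi>
    have e: "{x \<in> pts (emb X). nrm (emb X) x \<le> 1} = (\<lambda>x. (x, 0)) ` {x \<in> pts X. nrm X x \<le> 1}"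
      by (auto simp: emb_def)
    show "nrm (fdual X) (a, \<phi>) =
       (SUP x\<in>{x \<in> pts (emb X). nrm (emb X) x \<le> 1}. norm ((\<lambda>(x, _). \<phi> x) x))"
      unfolding e image_image by (simp add: fdual_def)
  qed
qed (auto simp: fdual_def emb_def)

lemma is_dual_emb:
  assumes X: "normed_space X" and d: "is_dual X Y p"
  shows "is_dual (emb X) (emb Y) (\<lambda>(f, _) (x, _). p f x)"
  unfolding is_dual_def
proof (intro conjI)
  show "normed_space (emb Y)" using d by (auto simp: is_dual_def intro: emb_normed)
  show "\<forall>f\<in>pts (emb Y). bounded_linear_map (emb X) scalars ((\<lambda>(f, _) (x, _). p f x) f)"
    using d by (auto simp: emb_def[of Y] emb_blm is_dual_def)
  show "\<forall>\<phi>. bounded_linear_map (emb X) scalars \<phi> \<longrightarrow>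
        (\<exists>f\<in>pts (emb Y). \<forall>x\<in>pts (emb X). (\<lambda>(f, _) (x, _). p f x) f x = \<phi> x)"
  proof (intro allI impI)
    fix \<phi> :: "'b \<times> ('b \<Rightarrow> 'a) \<Rightarrow> 'a" assume \<phi>: "bounded_linear_map (emb X) scalars \<phi>"
    have "bounded_linear_map X scalars (\<lambda>x. \<phi> (x, 0))"
      using \<phi> by (auto simp: bounded_linear_map_def emb_def zero_fun_def plus_fun_def)
    then obtain f where "f \<in> pts Y" "\<forall>x\<in>pts X. p f x = \<phi> (x, 0)"
      using d unfolding is_dual_def by meson
    then show "\<exists>f\<in>pts (emb Y). \<forall>x\<in>pts (emb X). (\<lambda>(f, _) (x, _). p f x) f x = \<phi> x"
      by (intro bexI[of _ "(f, 0)"]) (auto simp: emb_def)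
  qed
  show "\<forall>f\<in>pts (emb Y). nrm (emb Y) f =
       (SUP x\<in>{x \<in> pts (emb X). nrm (emb X) x \<le> 1}. norm ((\<lambda>(f, _) (x, _). p f x) f x))"
  proof clarify
    fix a b assume a: "(a, b) \<in> pts (emb Y)"
    have e: "{x \<in> pts (emb X). nrm (emb X) x \<le> 1} = (\<lambda>x. (x, 0)) ` {x \<in> pts X. nrm X x \<le> 1}"
      by (auto simp: emb_def)
    show "nrm (emb Y) (a, b) =
       (SUP x\<in>{x \<in> pts (emb X). nrm (emb X) x \<le> 1}. norm ((\<lambda>(x, _). p a x) x))"
      unfolding e image_image using a d by (auto simp: emb_def is_dual_def)
  qed
qed (use d in \<open>auto simp: emb_def is_dual_def\<close>)

lemma dual_tower_extend:
  fixes T :: "('k::real_normed_field, 'u::ab_group_add) dtower"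
  assumes "dual_tower m T"
  shows "\<exists>T' :: ('k, 'u \<times> ('u \<Rightarrow> 'k)) dtower.
           dual_tower (Suc m) T' \<and> (\<forall>k\<le>m. dlev T' k = emb (dlev T k))"
proof (intro exI conjI)
  let ?T = "\<lparr>dlev = (\<lambda>k. if k \<le> m then emb (dlev T k) else fdual (dlev T m)),
    dpair = (\<lambda>k. if k < m then (\<lambda>(f, _) (x, _). dpair T k f x) else (\<lambda>(_, \<phi>) (x, _). \<phi> x))\<rparr>"
  show "\<forall>k\<le>m. dlev ?T k = emb (dlev T k)" by simp
  have n: "normed_space (dlev T k)" if "k \<le> m" for k using dual_tower_normed[OF assms that] .
  show "dual_tower (Suc m) ?T"
    unfolding dual_tower_def
  proof (intro conjI allI impI)
    show "normed_space (dlev ?T 0)" using emb_normed[OF n[of 0]] by simp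
    fix k assume "k < Suc m"
    then consider "k < m" | "k = m" by linarith
    then show "is_dual (dlev ?T k) (dlev ?T (Suc k)) (dpair ?T k)"
    proof cases
      case 1
      then show ?thesis using is_dual_emb[OF n[of k]] assms by (auto simp: dual_tower_def)
    next
      case 2
      then show ?thesis using is_dual_fdual[OF n[of m]] by simp
    qed
  qed
qed

end

theory Submission
  imports Defs
begin

text \<open>
  Write \<open>(a, \<beta>)\<close> for an element of the duplication. Its left and right multiplications on
  \<open>A \<times> B\<close> are triangular block operators: \<open>(x, y)\<close> goes to \<open>(a x + a\<cdot>y + \<beta>\<cdot>x, \<beta> y)\<close> and to
  \<open>(x a + y\<cdot>a + x\<cdot>\<beta>, y \<beta>)\<close>. The duplication and its duals are paired coordinatewise, so the
  adjoint of a block operator is the transposed block operator of the adjoints, and the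
  recursions for the actions and for the mixed operations take precisely these adjoints. Each
  dualization therefore turns an upper triangular action into a lower triangular one and
  conversely, while left and right change places; after \<open>2n\<close> steps the actions have the shape
  displayed above, with the operations induced on the \<open>2n\<close>-th duals as entries. This is
  \<open>dup_action_even\<close>. Its proof needs that all entries are bounded operators, as the adjoint of
  an operator is the element of the dual which represents a functional, and only bounded
  functionals are represented.

  With the block form at hand the rest is a comparison of components. A linear map \<open>D\<close> on the
  duplication is given by four maps from the factors to the factors of the dual, and its
  derivation identity at \<open>(a, \<beta>)\<close>, \<open>(b, \<gamma>)\<close> is the sum of the identities at the four pairs of
  elements of the factors. The pair \<open>(a, 0)\<close>, \<open>(b, 0)\<close> gives the rules for products in \<open>A\<close>,
  where the component in the dual of \<open>B\<close> vanishes because no block leads there from an action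
  of \<open>A\<close>. The pairs \<open>(0, \<beta>)\<close>, \<open>(b, 0)\<close> and \<open>(a, 0)\<close>, \<open>(0, \<gamma>)\<close> give the rules for the module
  actions, and the pair \<open>(0, \<beta>)\<close>, \<open>(0, \<gamma>)\<close> says that both components on \<open>B\<close> are derivations.
  Likewise, \<open>D\<close> is the inner derivation of an element if and only if both agree on the two factors.
\<close>

section \<open>Adjoint operators between levels of dual towers\<close>

lemma bounded_linear_mapD:
  assumes "bounded_linear_map X Y f"
  shows "x \<in> pts X \<Longrightarrow> f x \<in> pts Y"
    "x \<in> pts X \<Longrightarrow> y \<in> pts X \<Longrightarrow> f (x + y) = f x + f y"
    "x \<in> pts X \<Longrightarrow> f (scale X c x) = scale Y c (f x)"
  using assms by (auto simp: bounded_linear_map_def)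

text \<open>
  The constant in the definition of boundedness may be negative if the space is trivial.
\<close>

lemma bounded_linear_map_bound:
  assumes X: "normed_space X" and f: "bounded_linear_map X Y f"
  obtains K where "0 \<le> K" "\<And>x. x \<in> pts X \<Longrightarrow> nrm Y (f x) \<le> K * nrm X x"
proof -
  obtain K where K: "\<And>x. x \<in> pts X \<Longrightarrow> nrm Y (f x) \<le> K * nrm X x"
    using f unfolding bounded_linear_map_def by blast
  have "nrm Y (f x) \<le> \<bar>K\<bar> * nrm X x" if x: "x \<in> pts X" for x
  proof -
    have "K * nrm X x \<le> \<bar>K\<bar> * nrm X x"
      by (rule mult_right_mono) (use nspD(7)[OF X x] in auto)
    then show ?thesis using K[OF x] by linarith
  qed
  then show thesis using that[of "\<bar>K\<bar>"] by simp
qed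

lemma bounded_linear_map_compose:
  assumes Y: "normed_space Y"
    and f: "bounded_linear_map X Y f" and g: "bounded_linear_map Y Z g"
  shows "bounded_linear_map X Z (\<lambda>x. g (f x))"
  unfolding bounded_linear_map_def
proof (intro conjI)
  obtain K where K: "\<And>x. x \<in> pts X \<Longrightarrow> nrm Y (f x) \<le> K * nrm X x"
    using f unfolding bounded_linear_map_def by blast
  obtain L where L: "0 \<le> L" "\<And>y. y \<in> pts Y \<Longrightarrow> nrm Z (g y) \<le> L * nrm Y y"
    using bounded_linear_map_bound[OF Y g] by blast
  have "nrm Z (g (f x)) \<le> (L * K) * nrm X x" if x: "x \<in> pts X" for x
    using L(2)[OF bounded_linear_mapD(1)[OF f x]] mult_left_mono[OF K[OF x] L(1)]
    by (simp add: mult.assoc)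
  then show "\<exists>K. \<forall>x\<in>pts X. nrm Z (g (f x)) \<le> K * nrm X x" by blast
qed (use bounded_linear_mapD[OF f] bounded_linear_mapD[OF g] in auto)

lemma bounded_bilinear_map_partial:
  assumes X: "normed_space X" and Y: "normed_space Y"
    and f: "bounded_bilinear_map X Y Z f"
  shows "x \<in> pts X \<Longrightarrow> bounded_linear_map Y Z (f x)"
    "y \<in> pts Y \<Longrightarrow> bounded_linear_map X Z (\<lambda>x. f x y)"
proof -
  obtain K where K: "\<And>x y. x \<in> pts X \<Longrightarrow> y \<in> pts Y \<Longrightarrow> nrm Z (f x y) \<le> K * nrm X x * nrm Y y"
    using f unfolding bounded_bilinear_map_def by blast
  have K': "nrm Z (f x y) \<le> (K * nrm Y y) * nrm X x" if "x \<in> pts X" "y \<in> pts Y" for x y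
    using K[OF that] by (simp add: ac_simps)
  show "bounded_linear_map Y Z (f x)" if "x \<in> pts X"
    unfolding bounded_linear_map_def
    by (intro conjI) (use that K f in \<open>auto simp: bounded_bilinear_map_def\<close>)
  show "bounded_linear_map X Z (\<lambda>x. f x y)" if "y \<in> pts Y"
    unfolding bounded_linear_map_def
    by (intro conjI) (use that K' f in \<open>auto simp: bounded_bilinear_map_def\<close>)
qed

text \<open>
  Two elements with the same pairings differ by an element whose operator norm is \<open>0\<close>.
\<close>

lemma is_dual_eqI:
  assumes X: "normed_space X" and d: "is_dual X Y p" and f: "f \<in> pts Y" and g: "g \<in> pts Y"
    and eq: "\<And>x. x \<in> pts X \<Longrightarrow> p f x = p g x"
  shows "f = g"
proof -
  have Y: "normed_space Y" using d by (simp add: is_dual_def)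
  interpret module "scale Y" using nspD(2)[OF Y] .
  have mg: "- g \<in> pts Y" using nspD(6)[OF Y g, of "-1"] by simp
  have m: "f - g \<in> pts Y" using nspD(5)[OF Y f mg] by simp
  have "p (f - g) x = 0" if x: "x \<in> pts X" for x
  proof -
    have "p ((f - g) + g) x = p (f - g) x + p g x"
      using d m g x unfolding is_dual_def by blast
    then show ?thesis using eq[OF x] by simp
  qed
  then have "nrm Y (f - g) \<le> 0" by (intro dual_bound(2)[OF X d m]) simp
  then have "nrm Y (f - g) = 0" using nspD(7)[OF Y m] by simp
  then show ?thesis using nspD(9)[OF Y m] by simp
qed

lemma dual_towerD:
  assumes "dual_tower N T" "k < N"
  shows "is_dual (dlev T k) (dlev T (Suc k)) (dpair T k)"
    "normed_space (dlev T k)" "normed_space (dlev T (Suc k))"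
  using assms dual_tower_normed[OF assms(1), of k] dual_tower_normed[OF assms(1), of "Suc k"]
  by (auto simp: dual_tower_def)

lemma dual_rep_eqI:
  assumes T: "dual_tower N T" and k: "k < N" and f: "f \<in> pts (dlev T (Suc k))"
    and eq: "\<And>x. x \<in> pts (dlev T k) \<Longrightarrow> dpair T k f x = \<phi> x"
  shows "dual_rep T k \<phi> = f"
  unfolding dual_rep_def
proof (rule the_equality)
  fix g assume "g \<in> pts (dlev T (Suc k)) \<and> (\<forall>x\<in>pts (dlev T k). dpair T k g x = \<phi> x)"
  then show "g = f"
    using is_dual_eqI[OF dual_towerD(2,1)[OF T k], of g f] f eq by simp
qed (use f eq in auto)

lemma dual_rep_mem:
  assumes T: "dual_tower N T" and k: "k < N"
    and \<phi>: "bounded_linear_map (dlev T k) scalars \<phi>"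
  shows "dual_rep T k \<phi> \<in> pts (dlev T (Suc k))"
    "x \<in> pts (dlev T k) \<Longrightarrow> dpair T k (dual_rep T k \<phi>) x = \<phi> x"
proof -
  obtain f where f: "f \<in> pts (dlev T (Suc k))" "\<forall>x\<in>pts (dlev T k). dpair T k f x = \<phi> x"
    using dual_towerD(1)[OF T k] \<phi> unfolding is_dual_def by meson
  then have "dual_rep T k \<phi> = f" using dual_rep_eqI[OF T k f(1)] by simp
  then show "dual_rep T k \<phi> \<in> pts (dlev T (Suc k))"
    "x \<in> pts (dlev T k) \<Longrightarrow> dpair T k (dual_rep T k \<phi>) x = \<phi> x"
    using f by auto
qed

text \<open>
  The adjoint of an operator \<open>L\<close> from the \<open>k\<close>-th level of \<open>T\<close> to the \<open>k\<close>-th level of \<open>T'\<close>. All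
  recursion equations of the dual actions and of the mixed operations are instances of it.
\<close>

definition adjoint ::
  "('k::real_normed_field, 'u::ab_group_add) dtower \<Rightarrow> ('k, 'w::ab_group_add) dtower
     \<Rightarrow> nat \<Rightarrow> ('u \<Rightarrow> 'w) \<Rightarrow> 'w \<Rightarrow> 'u" where
  "adjoint T T' k L f = dual_rep T k (\<lambda>x. dpair T' k f (L x))"

lemma adjoint_mem:
  assumes T: "dual_tower N T" and T': "dual_tower N T'" and k: "k < N"
    and L: "bounded_linear_map (dlev T k) (dlev T' k) L" and f: "f \<in> pts (dlev T' (Suc k))"
  shows "adjoint T T' k L f \<in> pts (dlev T (Suc k))"
    "x \<in> pts (dlev T k) \<Longrightarrow> dpair T k (adjoint T T' k L f) x = dpair T' k f (L x)"
proof -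
  have "bounded_linear_map (dlev T' k) scalars (dpair T' k f)"
    using dual_towerD(1)[OF T' k] f by (simp add: is_dual_def)
  note b = bounded_linear_map_compose[OF dual_towerD(2)[OF T' k] L this]
  show "adjoint T T' k L f \<in> pts (dlev T (Suc k))"
    "x \<in> pts (dlev T k) \<Longrightarrow> dpair T k (adjoint T T' k L f) x = dpair T' k f (L x)"
    unfolding adjoint_def using dual_rep_mem[OF T k b] by auto
qed

lemma adjoint_eqI:
  assumes "dual_tower N T" "k < N" "g \<in> pts (dlev T (Suc k))"
    and "\<And>x. x \<in> pts (dlev T k) \<Longrightarrow> dpair T k g x = dpair T' k f (L x)"
  shows "adjoint T T' k L f = g"
  unfolding adjoint_def using assms by (rule dual_rep_eqI)

lemma dpair_simps:
  assumes T: "dual_tower N T" and k: "k < N"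
    and f: "f \<in> pts (dlev T (Suc k))" and x: "x \<in> pts (dlev T k)"
  shows "g \<in> pts (dlev T (Suc k)) \<Longrightarrow> dpair T k (f + g) x = dpair T k f x + dpair T k g x"
    "dpair T k (scale (dlev T (Suc k)) c f) x = c * dpair T k f x"
    "y \<in> pts (dlev T k) \<Longrightarrow> dpair T k f (x + y) = dpair T k f x + dpair T k f y"
    "dpair T k f 0 = 0" "dpair T k 0 x = 0"
proof -
  note d = dual_towerD(1)[OF T k]
  have b: "bounded_linear_map (dlev T k) scalars (dpair T k f)"
    using d f by (simp add: is_dual_def)
  show "g \<in> pts (dlev T (Suc k)) \<Longrightarrow> dpair T k (f + g) x = dpair T k f x + dpair T k g x"
    "dpair T k (scale (dlev T (Suc k)) c f) x = c * dpair T k f x"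
    using d f x unfolding is_dual_def by blast+
  show "y \<in> pts (dlev T k) \<Longrightarrow> dpair T k f (x + y) = dpair T k f x + dpair T k f y"
    using bounded_linear_mapD(2)[OF b x] .
  show "dpair T k f 0 = 0" using blm0[OF dual_towerD(2)[OF T k] b] .
  have "0 \<in> pts (dlev T (Suc k))" using nspD(4)[OF dual_towerD(3)[OF T k]] .
  then have "dpair T k (0 + 0) x = dpair T k 0 x + dpair T k 0 x"
    using d x unfolding is_dual_def by blast
  then show "dpair T k 0 x = 0" by simp
qed

text \<open>
  Boundedness is inherited with the same constant, because the norm of a functional is its operator
  norm: \<open>|\<langle>L* f, x\<rangle>| = |\<langle>f, L x\<rangle>| \<le> \<parallel>f\<parallel> K \<parallel>x\<parallel>\<close>.
\<close>

lemma adjoint_bounded_linear: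
  assumes T: "dual_tower N T" and T': "dual_tower N T'" and k: "k < N"
    and L: "bounded_linear_map (dlev T k) (dlev T' k) L"
  shows "bounded_linear_map (dlev T' (Suc k)) (dlev T (Suc k)) (adjoint T T' k L)"
  unfolding bounded_linear_map_def
proof (intro conjI ballI allI)
  note A = adjoint_mem[OF T T' k L]
  note n = dual_towerD[OF T k] and n' = dual_towerD[OF T' k]
  note Lin = bounded_linear_mapD(1)[OF L]
  fix f assume f: "f \<in> pts (dlev T' (Suc k))"
  show "adjoint T T' k L f \<in> pts (dlev T (Suc k))" using A(1)[OF f] .
  show "adjoint T T' k L (f + g) = adjoint T T' k L f + adjoint T T' k L g"
    if g: "g \<in> pts (dlev T' (Suc k))" for g
    by (rule adjoint_eqI[OF T k])
      (auto simp: A f g Lin nspD(5)[OF n(3)] dpair_simps(1)[OF T k] dpair_simps(1)[OF T' k])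
  show "adjoint T T' k L (scale (dlev T' (Suc k)) c f) = scale (dlev T (Suc k)) c (adjoint T T' k L f)"
    for c
    by (rule adjoint_eqI[OF T k])
      (auto simp: A f Lin nspD(6)[OF n(3)] dpair_simps(2)[OF T k] dpair_simps(2)[OF T' k])
next
  note A = adjoint_mem[OF T T' k L]
  note n = dual_towerD[OF T k] and n' = dual_towerD[OF T' k]
  note Lin = bounded_linear_mapD(1)[OF L]
  obtain K where K: "0 \<le> K"
    "\<And>x. x \<in> pts (dlev T k) \<Longrightarrow> nrm (dlev T' k) (L x) \<le> K * nrm (dlev T k) x"
    using bounded_linear_map_bound[OF n(2) L] by blast
  have "nrm (dlev T (Suc k)) (adjoint T T' k L f) \<le> K * nrm (dlev T' (Suc k)) f"
    if f: "f \<in> pts (dlev T' (Suc k))" for f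
  proof (rule dual_bound(2)[OF n(2,1) A(1)[OF f]])
    fix x assume x: "x \<in> pts (dlev T k)" "nrm (dlev T k) x \<le> 1"
    have "nrm (dlev T' k) (L x) \<le> K"
      using K(2)[OF x(1)] mult_left_mono[OF x(2) K(1)] by simp
    then have "nrm (dlev T' (Suc k)) f * nrm (dlev T' k) (L x) \<le> nrm (dlev T' (Suc k)) f * K"
      by (rule mult_left_mono) (use nspD(7)[OF n'(3) f] in auto)
    then show "norm (dpair T k (adjoint T T' k L f) x) \<le> K * nrm (dlev T' (Suc k)) f"
      using dual_bound(1)[OF n'(2,1) f Lin[OF x(1)]] A(2)[OF f x(1)] by (simp add: mult.commute)
  qed
  then show "\<exists>K. \<forall>f\<in>pts (dlev T' (Suc k)).
      nrm (dlev T (Suc k)) (adjoint T T' k L f) \<le> K * nrm (dlev T' (Suc k)) f"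
    by blast
qed

lemma adjoint_zero:
  assumes T: "dual_tower N T" and T': "dual_tower N T'" and k: "k < N"
    and L: "\<And>x. x \<in> pts (dlev T k) \<Longrightarrow> L x = 0" and f: "f \<in> pts (dlev T' (Suc k))"
  shows "adjoint T T' k L f = 0"
proof (rule adjoint_eqI[OF T k])
  have z: "0 \<in> pts (dlev T (Suc k))" "0 \<in> pts (dlev T' k)"
    using nspD(4) dual_towerD[OF T k] dual_towerD[OF T' k] by auto
  show "0 \<in> pts (dlev T (Suc k))" by (rule z)
  show "dpair T k 0 x = dpair T' k f (L x)" if "x \<in> pts (dlev T k)" for x
    using L that dpair_simps(5)[OF T k z(1) that] dpair_simps(4)[OF T' k f z(2)] by simp
qed


section \<open>The induced operations on the iterated duals\<close>

lemma dual_left_Suc: "dual_left T l r (Suc k) c = adjoint T T k (\<lambda>x. dual_right T l r k x c)"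
  and dual_right_Suc: "(\<lambda>f. dual_right T l r (Suc k) f c) = adjoint T T k (dual_left T l r k c)"
  by (simp_all add: adjoint_def fun_eq_iff)

lemma dual_actions_bounded_linear:
  assumes T: "dual_tower N T"
    and l: "bounded_linear_map (dlev T 0) (dlev T 0) (l c)"
    and r: "bounded_linear_map (dlev T 0) (dlev T 0) (\<lambda>x. r x c)"
  shows "k \<le> N \<Longrightarrow> bounded_linear_map (dlev T k) (dlev T k) (dual_left T l r k c)"
    "k \<le> N \<Longrightarrow> bounded_linear_map (dlev T k) (dlev T k) (\<lambda>x. dual_right T l r k x c)"
proof (induction k)
  case 0
  { case 1 then show ?case using l by simp }
  { case 2 then show ?case using r by simp }
next
  case (Suc k)
  { case 1 then show ?case unfolding dual_left_Suc
      using Suc.IH(2) adjoint_bounded_linear[OF T T] by simp }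
  { case 2 then show ?case unfolding dual_right_Suc
      using Suc.IH(1) adjoint_bounded_linear[OF T T] by simp }
qed

text \<open>
  This serves for \<open>c = 0\<close>, to drop the actions of the zero component of an element \<open>(a, 0)\<close> or
  \<open>(0, \<beta>)\<close> of the duplication. The operator \<open>0\<close> has the adjoint \<open>0\<close> on every level.
\<close>

lemma dual_actions_zero:
  assumes T: "dual_tower N T"
    and l: "\<And>x. x \<in> pts (dlev T 0) \<Longrightarrow> l c x = 0"
    and r: "\<And>x. x \<in> pts (dlev T 0) \<Longrightarrow> r x c = 0"
  shows "k \<le> N \<Longrightarrow> x \<in> pts (dlev T k) \<Longrightarrow> dual_left T l r k c x = 0"
    "k \<le> N \<Longrightarrow> x \<in> pts (dlev T k) \<Longrightarrow> dual_right T l r k x c = 0"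
proof (induction k arbitrary: x)
  case 0
  { case 1 then show ?case using l by simp }
  { case 2 then show ?case using r by simp }
next
  case (Suc k)
  { case 1 then show ?case unfolding dual_left_Suc
      using Suc.IH(2) adjoint_zero[OF T T] by simp }
  { case 2 then show ?case
      using Suc.IH(1) adjoint_zero[OF T T] fun_cong[OF dual_right_Suc[of T l r k c], of x] by simp }
qed

lemma mix_left_odd_adjoint:
    "mix_left_odd S m a = adjoint (towB S) (towA S) (2 * m) (\<lambda>y. mix_right_even S m y a)"
  and mix_right_odd_adjoint:
    "(\<lambda>x. mix_right_odd S m x a) = adjoint (towB S) (towA S) (2 * m) (mix_left_even S m a)"
  and mix_left_even_Suc:
    "mix_left_even S (Suc m) a =
       adjoint (towA S) (towB S) (2 * m + 1) (\<lambda>x. mix_right_odd S m x a)"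
  and mix_right_even_Suc:
    "(\<lambda>y. mix_right_even S (Suc m) y a) =
       adjoint (towA S) (towB S) (2 * m + 1) (mix_left_odd S m a)"
  by (simp_all add: adjoint_def fun_eq_iff)

lemma dup_mul_Pair:
  "dup_mul S (a, \<beta>) (b, \<gamma>) = (mulA S a b + actR S a \<gamma> + actL S \<beta> b, mulB S \<beta> \<gamma>)"
  by (simp add: dup_mul_def)

lemma levDup_simps [simp]:
  "pts (levDup S k) = pts (levA S k) \<times> pts (levB S k)"
  "scale (levDup S k) c (x, y) = (scale (levA S k) c x, scale (levB S k) c y)"
  "nrm (levDup S (2 * n)) (x, y) = nrm (levA S (2 * n)) x + nrm (levB S (2 * n)) y"
  "nrm (levDup S 0) (x, y) = nrm (levA S 0) x + nrm (levB S 0) y"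
  "dpair (dup_tower S) k (f, g) (x, y) = dpair (towA S) k f x + dpair (towB S) k g y"
  by (simp_all add: dup_tower_def)

text \<open>
  The height \<open>N\<close> of the towers is kept apart from the order of the dual under consideration, so
  that inductions over the order stay inside fixed towers.
\<close>

locale duplication =
  fixes S :: "('k::real_normed_field, 'u::ab_group_add, 'v::ab_group_add) dup_data" and N :: nat
  assumes tower_A: "dual_tower N (towA S)" and tower_B: "dual_tower N (towB S)"
    and bilinear_mulA: "bounded_bilinear_map (levA S 0) (levA S 0) (levA S 0) (mulA S)"
    and bilinear_mulB: "bounded_bilinear_map (levB S 0) (levB S 0) (levB S 0) (mulB S)"
    and bilinear_actL: "bounded_bilinear_map (levB S 0) (levA S 0) (levA S 0) (actL S)"
    and bilinear_actR: "bounded_bilinear_map (levA S 0) (levB S 0) (levA S 0) (actR S)"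
begin

lemma normed_A: "k \<le> N \<Longrightarrow> normed_space (levA S k)"
  and normed_B: "k \<le> N \<Longrightarrow> normed_space (levB S k)"
  using dual_tower_normed[OF tower_A] dual_tower_normed[OF tower_B] by auto

lemma zero_mem [simp]: "k \<le> N \<Longrightarrow> 0 \<in> pts (levA S k)" "k \<le> N \<Longrightarrow> 0 \<in> pts (levB S k)"
  using nspD(4)[OF normed_A] nspD(4)[OF normed_B] by auto

lemma zero_mem0 [simp]: "0 \<in> pts (levA S 0)" "0 \<in> pts (levB S 0)"
  using zero_mem[of 0] by auto

lemma add_mem:
  "k \<le> N \<Longrightarrow> x \<in> pts (levA S k) \<Longrightarrow> x' \<in> pts (levA S k) \<Longrightarrow> x + x' \<in> pts (levA S k)"
  "k \<le> N \<Longrightarrow> y \<in> pts (levB S k) \<Longrightarrow> y' \<in> pts (levB S k) \<Longrightarrow> y + y' \<in> pts (levB S k)"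
  using nspD(5)[OF normed_A] nspD(5)[OF normed_B] by auto

lemma partial_linear:
  "a \<in> pts (levA S 0) \<Longrightarrow> bounded_linear_map (levA S 0) (levA S 0) (mulA S a)"
  "a \<in> pts (levA S 0) \<Longrightarrow> bounded_linear_map (levA S 0) (levA S 0) (\<lambda>b. mulA S b a)"
  "\<beta> \<in> pts (levB S 0) \<Longrightarrow> bounded_linear_map (levB S 0) (levB S 0) (mulB S \<beta>)"
  "\<beta> \<in> pts (levB S 0) \<Longrightarrow> bounded_linear_map (levB S 0) (levB S 0) (\<lambda>\<gamma>. mulB S \<gamma> \<beta>)"
  "\<beta> \<in> pts (levB S 0) \<Longrightarrow> bounded_linear_map (levA S 0) (levA S 0) (actL S \<beta>)"
  "a \<in> pts (levA S 0) \<Longrightarrow> bounded_linear_map (levB S 0) (levA S 0) (\<lambda>\<beta>. actL S \<beta> a)"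
  "a \<in> pts (levA S 0) \<Longrightarrow> bounded_linear_map (levB S 0) (levA S 0) (actR S a)"
  "\<beta> \<in> pts (levB S 0) \<Longrightarrow> bounded_linear_map (levA S 0) (levA S 0) (\<lambda>a. actR S a \<beta>)"
  using bounded_bilinear_map_partial[OF _ _ bilinear_mulA]
    bounded_bilinear_map_partial[OF _ _ bilinear_mulB]
    bounded_bilinear_map_partial[OF _ _ bilinear_actL]
    bounded_bilinear_map_partial[OF _ _ bilinear_actR] normed_A[of 0] normed_B[of 0]
  by auto

lemma partial_zero:
  assumes "a \<in> pts (levA S 0)" "\<beta> \<in> pts (levB S 0)"
  shows "mulA S 0 a = 0" "mulA S a 0 = 0" "mulB S 0 \<beta> = 0" "mulB S \<beta> 0 = 0"
    "actL S 0 a = 0" "actL S \<beta> 0 = 0" "actR S a 0 = 0" "actR S 0 \<beta> = 0"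
  using blm0[OF _ partial_linear(1)] blm0[OF _ partial_linear(2)] blm0[OF _ partial_linear(3)]
    blm0[OF _ partial_linear(4)] blm0[OF _ partial_linear(5)] blm0[OF _ partial_linear(6)]
    blm0[OF _ partial_linear(7)] blm0[OF _ partial_linear(8)] normed_A[of 0] normed_B[of 0] assms
  by auto

lemma actions_bounded_linear:
  assumes "k \<le> N"
  shows "a \<in> pts (levA S 0) \<Longrightarrow> bounded_linear_map (levA S k) (levA S k) (AA_left S k a)"
    "a \<in> pts (levA S 0) \<Longrightarrow> bounded_linear_map (levA S k) (levA S k) (\<lambda>x. AA_right S k x a)"
    "\<beta> \<in> pts (levB S 0) \<Longrightarrow> bounded_linear_map (levB S k) (levB S k) (BB_left S k \<beta>)"
    "\<beta> \<in> pts (levB S 0) \<Longrightarrow> bounded_linear_map (levB S k) (levB S k) (\<lambda>y. BB_right S k y \<beta>)"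
    "\<beta> \<in> pts (levB S 0) \<Longrightarrow> bounded_linear_map (levA S k) (levA S k) (BA_left S k \<beta>)"
    "\<beta> \<in> pts (levB S 0) \<Longrightarrow> bounded_linear_map (levA S k) (levA S k) (\<lambda>x. BA_right S k x \<beta>)"
  using assms by (intro dual_actions_bounded_linear[OF tower_A]
      dual_actions_bounded_linear[OF tower_B] partial_linear; simp)+

lemma actions_zero:
  assumes "k \<le> N"
  shows "x \<in> pts (levA S k) \<Longrightarrow> AA_left S k 0 x = 0" "x \<in> pts (levA S k) \<Longrightarrow> AA_right S k x 0 = 0"
    "y \<in> pts (levB S k) \<Longrightarrow> BB_left S k 0 y = 0" "y \<in> pts (levB S k) \<Longrightarrow> BB_right S k y 0 = 0"
    "x \<in> pts (levA S k) \<Longrightarrow> BA_left S k 0 x = 0" "x \<in> pts (levA S k) \<Longrightarrow> BA_right S k x 0 = 0"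
  using assms partial_zero[OF _ zero_mem0(2)] partial_zero[OF zero_mem0(1)]
  by (auto intro!: dual_actions_zero[OF tower_A] dual_actions_zero[OF tower_B])

text \<open>
  The odd operations at \<open>m\<close> are the adjoints of the even ones at \<open>m\<close>, and for \<open>m > 0\<close> these are the
  adjoints of the odd ones at \<open>m - 1\<close>. An induction over the even ones thus passes through each odd one;
  that half step is separated here, as it is the whole argument for the odd operations.
\<close>

lemma mix_odd_bounded_linear_if_even:
  assumes "2 * m < N"
    and "bounded_linear_map (levB S (2*m)) (levA S (2*m)) (mix_left_even S m a)"
    and "bounded_linear_map (levB S (2*m)) (levA S (2*m)) (\<lambda>y. mix_right_even S m y a)"
  shows "bounded_linear_map (levA S (2*m+1)) (levB S (2*m+1)) (mix_left_odd S m a)"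
    "bounded_linear_map (levA S (2*m+1)) (levB S (2*m+1)) (\<lambda>x. mix_right_odd S m x a)"
  using adjoint_bounded_linear[OF tower_B tower_A assms(1)] assms(2,3)
  unfolding mix_left_odd_adjoint mix_right_odd_adjoint by auto

lemma mix_even_bounded_linear:
  assumes a: "a \<in> pts (levA S 0)"
  shows "2 * m \<le> N \<Longrightarrow> bounded_linear_map (levB S (2*m)) (levA S (2*m)) (mix_left_even S m a)"
    "2 * m \<le> N \<Longrightarrow> bounded_linear_map (levB S (2*m)) (levA S (2*m)) (\<lambda>y. mix_right_even S m y a)"
proof (induction m)
  case 0
  { case 1 then show ?case using partial_linear(7)[OF a] by simp }
  { case 2 then show ?case using partial_linear(6)[OF a] by simp }
next
  case (Suc m)
  have lt: "2 * m + 1 < N" if "2 * Suc m \<le> N" using that by simp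
  have odd: "bounded_linear_map (levA S (2*m+1)) (levB S (2*m+1)) (mix_left_odd S m a)"
    "bounded_linear_map (levA S (2*m+1)) (levB S (2*m+1)) (\<lambda>x. mix_right_odd S m x a)"
    if "2 * Suc m \<le> N"
    using mix_odd_bounded_linear_if_even[of m a] Suc.IH lt[OF that] by simp_all
  { case 1 then show ?case unfolding mix_left_even_Suc
      using adjoint_bounded_linear[OF tower_A tower_B lt odd(2)] by simp }
  { case 2 then show ?case unfolding mix_right_even_Suc
      using adjoint_bounded_linear[OF tower_A tower_B lt odd(1)] by simp }
qed

lemma mix_odd_bounded_linear:
  assumes "a \<in> pts (levA S 0)" "2 * m < N"
  shows "bounded_linear_map (levA S (2*m+1)) (levB S (2*m+1)) (mix_left_odd S m a)"
    "bounded_linear_map (levA S (2*m+1)) (levB S (2*m+1)) (\<lambda>x. mix_right_odd S m x a)"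
  using mix_odd_bounded_linear_if_even[OF assms(2)] mix_even_bounded_linear[OF assms(1), of m] assms(2)
  by simp_all

lemma mix_even_zero:
  "2 * m \<le> N \<Longrightarrow> y \<in> pts (levB S (2*m)) \<Longrightarrow> mix_left_even S m 0 y = 0"
  "2 * m \<le> N \<Longrightarrow> y \<in> pts (levB S (2*m)) \<Longrightarrow> mix_right_even S m y 0 = 0"
proof (induction m arbitrary: y)
  case 0
  { case 1 then show ?case using partial_zero(8)[of 0 y] by simp }
  { case 2 then show ?case using partial_zero(6)[of 0 y] by simp }
next
  case (Suc m)
  have odd: "mix_left_odd S m 0 x = 0" "mix_right_odd S m x 0 = 0"
    if "2 * Suc m \<le> N" "x \<in> pts (levA S (2*m+1))" for x
  proof -
    have lt: "2 * m < N" and le: "2 * m \<le> N" and x: "x \<in> pts (levA S (Suc (2 * m)))"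
      using that by simp_all
    show "mix_left_odd S m 0 x = 0" unfolding mix_left_odd_adjoint
      by (rule adjoint_zero[OF tower_B tower_A lt Suc.IH(2)[OF le] x])
    show "mix_right_odd S m x 0 = 0"
      using fun_cong[OF mix_right_odd_adjoint[of S m 0], of x]
        adjoint_zero[OF tower_B tower_A lt Suc.IH(1)[OF le] x] by simp
  qed
  { case 1
    then have lt: "2 * m + 1 < N" and y: "y \<in> pts (levB S (Suc (2 * m + 1)))" by simp_all
    show ?case unfolding mix_left_even_Suc
      by (rule adjoint_zero[OF tower_A tower_B lt odd(2)[OF 1(1)] y]) }
  { case 2
    then have lt: "2 * m + 1 < N" and y: "y \<in> pts (levB S (Suc (2 * m + 1)))" by simp_all
    have "mix_right_even S (Suc m) y 0 =
        adjoint (towA S) (towB S) (2 * m + 1) (mix_left_odd S m 0) y"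
      by (rule fun_cong[OF mix_right_even_Suc])
    also have "\<dots> = 0" by (rule adjoint_zero[OF tower_A tower_B lt odd(1)[OF 2(1)] y])
    finally show ?case . }
qed


section \<open>Block form of the actions of the duplication\<close>

text \<open>
  Here \<open>P\<close> and \<open>R\<close> share a block: they are the operators of \<open>a\<close> and of \<open>\<beta>\<close> on the same level.
  Testing the claimed value on \<open>(x, y)\<close> gives \<open>\<langle>f, P x + Q y + R x\<rangle> + \<langle>g, U y\<rangle>\<close>; collecting the
  terms in \<open>x\<close> and those in \<open>y\<close> moves \<open>Q\<close> to the second component.
\<close>

lemma adjoint_upper_block:
  assumes k: "k < N"
    and P: "bounded_linear_map (levA S k) (levA S k) P"
    and Q: "bounded_linear_map (levB S k) (levA S k) Q"
    and R: "bounded_linear_map (levA S k) (levA S k) R"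
    and U: "bounded_linear_map (levB S k) (levB S k) U"
    and M: "\<And>x y. x \<in> pts (levA S k) \<Longrightarrow> y \<in> pts (levB S k) \<Longrightarrow> M (x, y) = (P x + Q y + R x, U y)"
    and f: "f \<in> pts (levA S (Suc k))" and g: "g \<in> pts (levB S (Suc k))"
  shows "adjoint (dup_tower S) (dup_tower S) k M (f, g) =
    (adjoint (towA S) (towA S) k P f + adjoint (towA S) (towA S) k R f,
     adjoint (towB S) (towA S) k Q f + adjoint (towB S) (towB S) k U g)"
proof (rule adjoint_eqI[OF dual_tower_dup[OF tower_A tower_B] k])
  note mem = adjoint_mem[OF tower_A tower_A k P f] adjoint_mem[OF tower_B tower_A k Q f]
    adjoint_mem[OF tower_A tower_A k R f] adjoint_mem[OF tower_B tower_B k U g]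
  note lin = bounded_linear_mapD(1)[OF P] bounded_linear_mapD(1)[OF Q] bounded_linear_mapD(1)[OF R]
    bounded_linear_mapD(1)[OF U]
  have k': "Suc k \<le> N" "k \<le> N" using k by simp_all
  show "(adjoint (towA S) (towA S) k P f + adjoint (towA S) (towA S) k R f,
     adjoint (towB S) (towA S) k Q f + adjoint (towB S) (towB S) k U g) \<in> pts (levDup S (Suc k))"
    using mem k' by (simp add: add_mem)
  fix z assume "z \<in> pts (levDup S k)"
  then obtain x y where z: "z = (x, y)" and x: "x \<in> pts (levA S k)" and y: "y \<in> pts (levB S k)"
    by auto
  show "dpair (dup_tower S) k
     (adjoint (towA S) (towA S) k P f + adjoint (towA S) (towA S) k R f,
      adjoint (towB S) (towA S) k Q f + adjoint (towB S) (towB S) k U g) z =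
     dpair (dup_tower S) k (f, g) (M z)"
    using mem lin x y f g k'
    by (simp add: z M add_mem dpair_simps(1,3)[OF tower_A k] dpair_simps(1,3)[OF tower_B k])
qed

text \<open>
  The same regrouping moves \<open>Q\<close> back to the first component.
\<close>

lemma adjoint_lower_block:
  assumes k: "k < N"
    and P: "bounded_linear_map (levA S k) (levA S k) P"
    and R: "bounded_linear_map (levA S k) (levA S k) R"
    and Q: "bounded_linear_map (levA S k) (levB S k) Q"
    and U: "bounded_linear_map (levB S k) (levB S k) U"
    and M: "\<And>x y. x \<in> pts (levA S k) \<Longrightarrow> y \<in> pts (levB S k) \<Longrightarrow> M (x, y) = (P x + R x, Q x + U y)"
    and f: "f \<in> pts (levA S (Suc k))" and g: "g \<in> pts (levB S (Suc k))"
  shows "adjoint (dup_tower S) (dup_tower S) k M (f, g) =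
    (adjoint (towA S) (towA S) k P f + adjoint (towA S) (towB S) k Q g
       + adjoint (towA S) (towA S) k R f,
     adjoint (towB S) (towB S) k U g)"
proof (rule adjoint_eqI[OF dual_tower_dup[OF tower_A tower_B] k])
  note mem = adjoint_mem[OF tower_A tower_A k P f] adjoint_mem[OF tower_A tower_B k Q g]
    adjoint_mem[OF tower_A tower_A k R f] adjoint_mem[OF tower_B tower_B k U g]
  note lin = bounded_linear_mapD(1)[OF P] bounded_linear_mapD(1)[OF Q] bounded_linear_mapD(1)[OF R]
    bounded_linear_mapD(1)[OF U]
  have k': "Suc k \<le> N" "k \<le> N" using k by simp_all
  show "(adjoint (towA S) (towA S) k P f + adjoint (towA S) (towB S) k Q g
       + adjoint (towA S) (towA S) k R f,
     adjoint (towB S) (towB S) k U g) \<in> pts (levDup S (Suc k))"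
    using mem k' by (simp add: add_mem)
  fix z assume "z \<in> pts (levDup S k)"
  then obtain x y where z: "z = (x, y)" and x: "x \<in> pts (levA S k)" and y: "y \<in> pts (levB S k)"
    by auto
  show "dpair (dup_tower S) k
     (adjoint (towA S) (towA S) k P f + adjoint (towA S) (towB S) k Q g
       + adjoint (towA S) (towA S) k R f,
      adjoint (towB S) (towB S) k U g) z = dpair (dup_tower S) k (f, g) (M z)"
    using mem lin x y f g k'
    by (simp add: z M add_mem dpair_simps(1,3)[OF tower_A k] dpair_simps(1,3)[OF tower_B k])
qed

text \<open>
  Dualizing exchanges the sides: the left action on the odd level is the adjoint of the right
  action one level below, and similarly for the right action.
\<close>

lemma dup_action_odd_if_even:
  assumes a: "a \<in> pts (levA S 0)" and \<beta>: "\<beta> \<in> pts (levB S 0)" and m: "2 * m < N"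
    and left: "\<And>x y. x \<in> pts (levA S (2*m)) \<Longrightarrow> y \<in> pts (levB S (2*m)) \<Longrightarrow>
      dup_left S (2*m) (a, \<beta>) (x, y) =
        (AA_left S (2*m) a x + mix_left_even S m a y + BA_left S (2*m) \<beta> x, BB_left S (2*m) \<beta> y)"
    and right: "\<And>x y. x \<in> pts (levA S (2*m)) \<Longrightarrow> y \<in> pts (levB S (2*m)) \<Longrightarrow>
      dup_right S (2*m) (x, y) (a, \<beta>) =
        (AA_right S (2*m) x a + mix_right_even S m y a + BA_right S (2*m) x \<beta>, BB_right S (2*m) y \<beta>)"
    and f: "f \<in> pts (levA S (2*m+1))" and g: "g \<in> pts (levB S (2*m+1))"
  shows "dup_left S (2*m+1) (a, \<beta>) (f, g) =
      (AA_left S (2*m+1) a f + BA_left S (2*m+1) \<beta> f, mix_left_odd S m a f + BB_left S (2*m+1) \<beta> g)"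
    "dup_right S (2*m+1) (f, g) (a, \<beta>) =
      (AA_right S (2*m+1) f a + BA_right S (2*m+1) f \<beta>, mix_right_odd S m f a + BB_right S (2*m+1) g \<beta>)"
proof -
  have le: "2 * m \<le> N" using m by simp
  note act = actions_bounded_linear[OF le] and mix = mix_even_bounded_linear[OF a le]
  have fg: "f \<in> pts (levA S (Suc (2*m)))" "g \<in> pts (levB S (Suc (2*m)))" using f g by simp_all
  show "dup_left S (2*m+1) (a, \<beta>) (f, g) =
      (AA_left S (2*m+1) a f + BA_left S (2*m+1) \<beta> f, mix_left_odd S m a f + BB_left S (2*m+1) \<beta> g)"
    using adjoint_upper_block[OF m act(2)[OF a] mix(2) act(6)[OF \<beta>] act(4)[OF \<beta>] right fg]
    by (simp add: adjoint_def)
  show "dup_right S (2*m+1) (f, g) (a, \<beta>) =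
      (AA_right S (2*m+1) f a + BA_right S (2*m+1) f \<beta>, mix_right_odd S m f a + BB_right S (2*m+1) g \<beta>)"
    using adjoint_upper_block[OF m act(1)[OF a] mix(1) act(5)[OF \<beta>] act(3)[OF \<beta>] left fg]
    by (simp add: adjoint_def)
qed

text \<open>
  The inductive step is two dualizations, from upper to lower triangular and back. Both sides
  have to be proved together because each dualization exchanges them.
\<close>

lemma dup_action_even:
  assumes a: "a \<in> pts (levA S 0)" and \<beta>: "\<beta> \<in> pts (levB S 0)"
  shows "2 * m \<le> N \<Longrightarrow> x \<in> pts (levA S (2*m)) \<Longrightarrow> y \<in> pts (levB S (2*m)) \<Longrightarrow>
      dup_left S (2*m) (a, \<beta>) (x, y) =
        (AA_left S (2*m) a x + mix_left_even S m a y + BA_left S (2*m) \<beta> x, BB_left S (2*m) \<beta> y)"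
    "2 * m \<le> N \<Longrightarrow> x \<in> pts (levA S (2*m)) \<Longrightarrow> y \<in> pts (levB S (2*m)) \<Longrightarrow>
      dup_right S (2*m) (x, y) (a, \<beta>) =
        (AA_right S (2*m) x a + mix_right_even S m y a + BA_right S (2*m) x \<beta>, BB_right S (2*m) y \<beta>)"
proof (induction m arbitrary: x y)
  case 0
  { case 1 then show ?case by (simp add: dup_mul_Pair) }
  { case 2 then show ?case by (simp add: dup_mul_Pair add.commute add.left_commute) }
next
  case (Suc m)
  have *: "dup_left S (2 * Suc m) (a, \<beta>) (x, y) =
        (AA_left S (2 * Suc m) a x + mix_left_even S (Suc m) a y + BA_left S (2 * Suc m) \<beta> x,
         BB_left S (2 * Suc m) \<beta> y)"
      "dup_right S (2 * Suc m) (x, y) (a, \<beta>) =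
        (AA_right S (2 * Suc m) x a + mix_right_even S (Suc m) y a + BA_right S (2 * Suc m) x \<beta>,
         BB_right S (2 * Suc m) y \<beta>)"
    if "2 * Suc m \<le> N" "x \<in> pts (levA S (2 * Suc m))" "y \<in> pts (levB S (2 * Suc m))" for x y
  proof -
    have lt: "2 * m < N" and lt1: "2 * m + 1 < N" and le: "2 * m \<le> N" "2 * m + 1 \<le> N"
      using that by simp_all
    have xy: "x \<in> pts (levA S (Suc (2*m+1)))" "y \<in> pts (levB S (Suc (2*m+1)))"
      using that by simp_all
    note odd = dup_action_odd_if_even[OF a \<beta> lt Suc.IH[OF le(1)]]
    note act = actions_bounded_linear[OF le(2)] and mix = mix_odd_bounded_linear[OF a lt]
    show "dup_left S (2 * Suc m) (a, \<beta>) (x, y) =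
        (AA_left S (2 * Suc m) a x + mix_left_even S (Suc m) a y + BA_left S (2 * Suc m) \<beta> x,
         BB_left S (2 * Suc m) \<beta> y)"
      using adjoint_lower_block[OF lt1 act(2)[OF a] act(6)[OF \<beta>] mix(2) act(4)[OF \<beta>] odd(2) xy]
      by (simp add: adjoint_def)
    show "dup_right S (2 * Suc m) (x, y) (a, \<beta>) =
        (AA_right S (2 * Suc m) x a + mix_right_even S (Suc m) y a + BA_right S (2 * Suc m) x \<beta>,
         BB_right S (2 * Suc m) y \<beta>)"
      using adjoint_lower_block[OF lt1 act(1)[OF a] act(5)[OF \<beta>] mix(1) act(3)[OF \<beta>] odd(1) xy]
      by (simp add: adjoint_def)
  qed
  { case 1 then show ?case by (rule *(1)) }
  { case 2 then show ?case by (rule *(2)) }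
qed

end

section \<open>Derivations of the duplication and their components\<close>

context duplication
begin

lemma mix_even_simps:
  assumes "2 * n \<le> N" "a \<in> pts (levA S 0)" "y \<in> pts (levB S (2*n))"
  shows "mix_left_even S n a y \<in> pts (levA S (2*n))" "mix_right_even S n y a \<in> pts (levA S (2*n))"
    "y' \<in> pts (levB S (2*n)) \<Longrightarrow> mix_left_even S n a (y + y') = mix_left_even S n a y + mix_left_even S n a y'"
    "y' \<in> pts (levB S (2*n)) \<Longrightarrow> mix_right_even S n (y + y') a = mix_right_even S n y a + mix_right_even S n y' a"
    "mix_left_even S n a 0 = 0" "mix_right_even S n 0 a = 0"
  using bounded_linear_mapD(1,2)[OF mix_even_bounded_linear(1)[OF assms(2,1)]]
    bounded_linear_mapD(1,2)[OF mix_even_bounded_linear(2)[OF assms(2,1)]]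
    blm0[OF normed_B[OF assms(1)] mix_even_bounded_linear(1)[OF assms(2,1)]]
    blm0[OF normed_B[OF assms(1)] mix_even_bounded_linear(2)[OF assms(2,1)]] assms(3)
  by auto

lemma actions_add:
  assumes k: "k \<le> N" and a: "a \<in> pts (levA S 0)" and \<beta>: "\<beta> \<in> pts (levB S 0)"
  shows "x \<in> pts (levA S k) \<Longrightarrow> x' \<in> pts (levA S k) \<Longrightarrow>
      AA_left S k a (x + x') = AA_left S k a x + AA_left S k a x'"
    "x \<in> pts (levA S k) \<Longrightarrow> x' \<in> pts (levA S k) \<Longrightarrow>
      AA_right S k (x + x') a = AA_right S k x a + AA_right S k x' a"
    "y \<in> pts (levB S k) \<Longrightarrow> y' \<in> pts (levB S k) \<Longrightarrow>
      BB_left S k \<beta> (y + y') = BB_left S k \<beta> y + BB_left S k \<beta> y'"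
    "y \<in> pts (levB S k) \<Longrightarrow> y' \<in> pts (levB S k) \<Longrightarrow>
      BB_right S k (y + y') \<beta> = BB_right S k y \<beta> + BB_right S k y' \<beta>"
    "x \<in> pts (levA S k) \<Longrightarrow> x' \<in> pts (levA S k) \<Longrightarrow>
      BA_left S k \<beta> (x + x') = BA_left S k \<beta> x + BA_left S k \<beta> x'"
    "x \<in> pts (levA S k) \<Longrightarrow> x' \<in> pts (levA S k) \<Longrightarrow>
      BA_right S k (x + x') \<beta> = BA_right S k x \<beta> + BA_right S k x' \<beta>"
  using bounded_linear_mapD(2)[OF actions_bounded_linear(1)[OF k a]]
    bounded_linear_mapD(2)[OF actions_bounded_linear(2)[OF k a]]
    bounded_linear_mapD(2)[OF actions_bounded_linear(3)[OF k \<beta>]]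
    bounded_linear_mapD(2)[OF actions_bounded_linear(4)[OF k \<beta>]]
    bounded_linear_mapD(2)[OF actions_bounded_linear(5)[OF k \<beta>]]
    bounded_linear_mapD(2)[OF actions_bounded_linear(6)[OF k \<beta>]]
  by auto

lemma product_mem:
  assumes "a \<in> pts (levA S 0)" "b \<in> pts (levA S 0)" "\<beta> \<in> pts (levB S 0)" "\<gamma> \<in> pts (levB S 0)"
  shows "mulA S a b \<in> pts (levA S 0)" "mulB S \<beta> \<gamma> \<in> pts (levB S 0)"
    "actL S \<beta> a \<in> pts (levA S 0)" "actR S a \<beta> \<in> pts (levA S 0)"
  using bounded_linear_mapD(1)[OF partial_linear(1)] bounded_linear_mapD(1)[OF partial_linear(3)]
    bounded_linear_mapD(1)[OF partial_linear(5)] bounded_linear_mapD(1)[OF partial_linear(8)] assms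
  by auto

lemma scale_zero: "scale (levA S 0) c 0 = 0" "scale (levB S 0) c 0 = 0"
  using module.scale_zero_right[OF nspD(2)[OF normed_A]]
    module.scale_zero_right[OF nspD(2)[OF normed_B]] by auto

text \<open>
  The components arise from \<open>D\<close> by composing with the inclusions of the factors and with the
  projections, all of norm at most \<open>1\<close> because on levels of even order the norm of the
  duplication is the sum norm.
\<close>

lemma components_bounded_linear:
  assumes n: "2 * n \<le> N" and D: "bounded_linear_map (levDup S 0) (levDup S (2*n)) D"
  shows "bounded_linear_map (levA S 0) (levA S (2*n)) (\<lambda>a. fst (D (a, 0)))"
    "bounded_linear_map (levA S 0) (levB S (2*n)) (\<lambda>a. snd (D (a, 0)))"
    "bounded_linear_map (levB S 0) (levA S (2*n)) (\<lambda>\<beta>. fst (D (0, \<beta>)))"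
    "bounded_linear_map (levB S 0) (levB S (2*n)) (\<lambda>\<beta>. snd (D (0, \<beta>)))"
proof -
  have Dup: "normed_space (levDup S 0)"
    using dual_tower_normed[OF dual_tower_dup[OF tower_A tower_B]] by simp
  have inA: "bounded_linear_map (levA S 0) (levDup S 0) (\<lambda>a. (a, 0))"
    using nspD(8)[OF normed_B[of 0]] scale_zero
    by (auto simp: bounded_linear_map_def intro!: exI[of _ 1])
  have inB: "bounded_linear_map (levB S 0) (levDup S 0) (\<lambda>\<beta>. (0, \<beta>))"
    using nspD(8)[OF normed_A[of 0]] scale_zero
    by (auto simp: bounded_linear_map_def intro!: exI[of _ 1])
  have Dup': "normed_space (levDup S (2*n))"
    using dual_tower_normed[OF dual_tower_dup[OF tower_A tower_B]] n by simp
  have prA: "bounded_linear_map (levDup S (2*n)) (levA S (2*n)) fst"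
    using nspD(7)[OF normed_B[OF n]]
    by (auto simp: bounded_linear_map_def intro!: exI[of _ 1])
  have prB: "bounded_linear_map (levDup S (2*n)) (levB S (2*n)) snd"
    using nspD(7)[OF normed_A[OF n]]
    by (auto simp: bounded_linear_map_def intro!: exI[of _ 1])
  note c = bounded_linear_map_compose
  show "bounded_linear_map (levA S 0) (levA S (2*n)) (\<lambda>a. fst (D (a, 0)))"
    "bounded_linear_map (levA S 0) (levB S (2*n)) (\<lambda>a. snd (D (a, 0)))"
    "bounded_linear_map (levB S 0) (levA S (2*n)) (\<lambda>\<beta>. fst (D (0, \<beta>)))"
    "bounded_linear_map (levB S 0) (levB S (2*n)) (\<lambda>\<beta>. snd (D (0, \<beta>)))"
    using c[OF Dup' c[OF Dup inA D] prA] c[OF Dup' c[OF Dup inA D] prB]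
      c[OF Dup' c[OF Dup inB D] prA] c[OF Dup' c[OF Dup inB D] prB] by simp_all
qed

text \<open>
  Each identity of the decomposition is a component of the derivation identity at a pair of
  elements which lie in the factors. The terms that do not appear are actions by \<open>0\<close>.
\<close>

lemma dup_decomposition_if_derivation:
  assumes n: "2 * n \<le> N"
    and D: "derivation (levDup S 0) (dup_mul S) (levDup S (2*n))
      (dup_left S (2*n)) (dup_right S (2*n)) D"
  shows "dup_decomposition S n D (\<lambda>a. fst (D (a, 0))) (\<lambda>a. snd (D (a, 0)))
    (\<lambda>\<beta>. fst (D (0, \<beta>))) (\<lambda>\<beta>. snd (D (0, \<beta>)))"
proof -
  define A1 A2 B1 B2 where defs: "A1 = (\<lambda>a. fst (D (a, 0)))" "A2 = (\<lambda>a. snd (D (a, 0)))"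
    "B1 = (\<lambda>\<beta>. fst (D (0, \<beta>)))" "B2 = (\<lambda>\<beta>. snd (D (0, \<beta>)))"
  have bl: "bounded_linear_map (levDup S 0) (levDup S (2*n)) D"
    and leibniz: "\<And>z w. z \<in> pts (levDup S 0) \<Longrightarrow> w \<in> pts (levDup S 0) \<Longrightarrow>
      D (dup_mul S z w) = dup_right S (2*n) (D z) w + dup_left S (2*n) z (D w)"
    using D by (auto simp: derivation_def)
  have comp: "bounded_linear_map (levA S 0) (levA S (2*n)) A1"
    "bounded_linear_map (levA S 0) (levB S (2*n)) A2"
    "bounded_linear_map (levB S 0) (levA S (2*n)) B1"
    "bounded_linear_map (levB S 0) (levB S (2*n)) B2"
    unfolding defs by (rule components_bounded_linear[OF n bl])+
  note mem = bounded_linear_mapD(1)[OF comp(1)] bounded_linear_mapD(1)[OF comp(2)]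
    bounded_linear_mapD(1)[OF comp(3)] bounded_linear_mapD(1)[OF comp(4)]
  have DA: "D (a, 0) = (A1 a, A2 a)" for a by (simp add: defs)
  have DB: "D (0, \<beta>) = (B1 \<beta>, B2 \<beta>)" for \<beta> by (simp add: defs)
  note ev = dup_action_even[OF _ _ n]
  note zero = actions_zero[OF n] mix_even_zero[OF n]
  have AB: "D (a, \<beta>) = (A1 a + B1 \<beta>, A2 a + B2 \<beta>)"
    if "a \<in> pts (levA S 0)" "\<beta> \<in> pts (levB S 0)" for a \<beta>
    using bounded_linear_mapD(2)[OF bl, of "(a, 0)" "(0, \<beta>)"] that by (simp add: DA DB)
  have AA: "A1 (mulA S a b) = AA_right S (2*n) (A1 a) b + mix_right_even S n (A2 a) b
        + AA_left S (2*n) a (A1 b) + mix_left_even S n a (A2 b)" "A2 (mulA S a b) = 0"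
    if "a \<in> pts (levA S 0)" "b \<in> pts (levA S 0)" for a b
    using leibniz[of "(a, 0)" "(b, 0)"] that
    by (simp_all add: dup_mul_Pair partial_zero[OF _ zero_mem0(2)] DA ev mem zero)
  have BA: "A1 (actL S \<beta> a) = AA_right S (2*n) (B1 \<beta>) a + mix_right_even S n (B2 \<beta>) a
        + BA_left S (2*n) \<beta> (A1 a)" "A2 (actL S \<beta> a) = BB_left S (2*n) \<beta> (A2 a)"
    if "a \<in> pts (levA S 0)" "\<beta> \<in> pts (levB S 0)" for a \<beta>
    using leibniz[of "(0, \<beta>)" "(a, 0)"] that
    by (simp_all add: dup_mul_Pair partial_zero DA DB ev mem zero)
  have AR: "A1 (actR S a \<beta>) = AA_left S (2*n) a (B1 \<beta>) + mix_left_even S n a (B2 \<beta>)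
        + BA_right S (2*n) (A1 a) \<beta>" "A2 (actR S a \<beta>) = BB_right S (2*n) (A2 a) \<beta>"
    if "a \<in> pts (levA S 0)" "\<beta> \<in> pts (levB S 0)" for a \<beta>
    using leibniz[of "(a, 0)" "(0, \<beta>)"] that
    by (simp_all add: dup_mul_Pair partial_zero DA DB ev mem zero add.assoc add.commute add.left_commute)
  have BB: "B1 (mulB S \<beta> \<gamma>) = BA_right S (2*n) (B1 \<beta>) \<gamma> + BA_left S (2*n) \<beta> (B1 \<gamma>)"
    "B2 (mulB S \<beta> \<gamma>) = BB_right S (2*n) (B2 \<beta>) \<gamma> + BB_left S (2*n) \<beta> (B2 \<gamma>)"
    if "\<beta> \<in> pts (levB S 0)" "\<gamma> \<in> pts (levB S 0)" for \<beta> \<gamma>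
    using leibniz[of "(0, \<beta>)" "(0, \<gamma>)"] that
    by (simp_all add: dup_mul_Pair partial_zero[OF zero_mem0(1)] DB ev mem zero)
  have "dup_decomposition S n D A1 A2 B1 B2"
    unfolding dup_decomposition_def derivation_def bounded_bimodule_map_def
    by (intro conjI ballI comp) (simp_all add: AB AA BA AR BB)
  then show ?thesis unfolding defs .
qed

text \<open>
  Conversely, the product \<open>(a, \<beta>) (b, \<gamma>)\<close> is the sum of the four products of components, and the
  decomposition says what \<open>D\<close> does to each of them. Adding up gives all terms of the block form
  of the derivation identity.
\<close>

lemma derivation_if_dup_decomposition:
  assumes n: "2 * n \<le> N" and bl: "bounded_linear_map (levDup S 0) (levDup S (2*n)) D"
    and dec: "dup_decomposition S n D A1 A2 B1 B2"
  shows "derivation (levDup S 0) (dup_mul S) (levDup S (2*n))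
      (dup_left S (2*n)) (dup_right S (2*n)) D"
  unfolding derivation_def
proof (intro conjI ballI bl)
  have comp: "bounded_linear_map (levA S 0) (levA S (2*n)) A1"
    "bounded_linear_map (levA S 0) (levB S (2*n)) A2"
    "bounded_linear_map (levB S 0) (levA S (2*n)) B1"
    "bounded_linear_map (levB S 0) (levB S (2*n)) B2"
    using dec by (simp_all add: dup_decomposition_def derivation_def bounded_bimodule_map_def)
  note mem = bounded_linear_mapD(1)[OF comp(1)] bounded_linear_mapD(1)[OF comp(2)]
    bounded_linear_mapD(1)[OF comp(3)] bounded_linear_mapD(1)[OF comp(4)]
  note add = bounded_linear_mapD(2)[OF comp(1)] bounded_linear_mapD(2)[OF comp(2)]
  fix z w assume "z \<in> pts (levDup S 0)" "w \<in> pts (levDup S 0)"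
  then obtain a \<beta> b \<gamma> where zw: "z = (a, \<beta>)" "w = (b, \<gamma>)"
    and m: "a \<in> pts (levA S 0)" "b \<in> pts (levA S 0)" "\<beta> \<in> pts (levB S 0)" "\<gamma> \<in> pts (levB S 0)"
    by auto
  have AB: "D (a, \<beta>) = (A1 a + B1 \<beta>, A2 a + B2 \<beta>)"
    if "a \<in> pts (levA S 0)" "\<beta> \<in> pts (levB S 0)" for a \<beta>
    using dec that unfolding dup_decomposition_def by blast
  have laws: "A1 (mulA S a b) = AA_right S (2*n) (A1 a) b + mix_right_even S n (A2 a) b
        + AA_left S (2*n) a (A1 b) + mix_left_even S n a (A2 b)" "A2 (mulA S a b) = 0"
    "A1 (actL S \<beta> b) = AA_right S (2*n) (B1 \<beta>) b + mix_right_even S n (B2 \<beta>) b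
        + BA_left S (2*n) \<beta> (A1 b)" "A2 (actL S \<beta> b) = BB_left S (2*n) \<beta> (A2 b)"
    "A1 (actR S a \<gamma>) = AA_left S (2*n) a (B1 \<gamma>) + mix_left_even S n a (B2 \<gamma>)
        + BA_right S (2*n) (A1 a) \<gamma>" "A2 (actR S a \<gamma>) = BB_right S (2*n) (A2 a) \<gamma>"
    "B1 (mulB S \<beta> \<gamma>) = BA_right S (2*n) (B1 \<beta>) \<gamma> + BA_left S (2*n) \<beta> (B1 \<gamma>)"
    "B2 (mulB S \<beta> \<gamma>) = BB_right S (2*n) (B2 \<beta>) \<gamma> + BB_left S (2*n) \<beta> (B2 \<gamma>)"
    using dec m unfolding dup_decomposition_def derivation_def bounded_bimodule_map_def by blast+
  note pm = product_mem[OF m] product_mem[OF m(1,2,4,3)] product_mem[OF m(2,1,3,4)]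
  show "D (dup_mul S z w) = dup_right S (2*n) (D z) w + dup_left S (2*n) z (D w)"
    using m pm
    by (simp add: zw dup_mul_Pair AB add add_mem laws mem n dup_action_even[OF _ _ n]
        actions_add[OF n m(1) m(3)] actions_add[OF n m(2) m(4)] mix_even_simps[OF n] add.assoc add.commute add.left_commute)
qed

text \<open>
  By the block form, the inner derivation at \<open>(a, \<beta>)\<close> is a sum of a term in \<open>a\<close> and a term in \<open>\<beta>\<close>,
  and the term in \<open>a\<close> has no component in \<open>B\<close>. Setting \<open>\<beta> = 0\<close> and \<open>a = 0\<close> separates them.
\<close>

lemma inner_iff_components:
  assumes n: "2 * n \<le> N" and dec: "dup_decomposition S n D A1 A2 B1 B2"
    and x: "x \<in> pts (levA S (2*n))" and y: "y \<in> pts (levB S (2*n))"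
  shows "(\<forall>z\<in>pts (levDup S 0). D z = ad (dup_left S (2*n)) (dup_right S (2*n)) (x, y) z) \<longleftrightarrow>
    (\<forall>\<beta>\<in>pts (levB S 0). B1 \<beta> = ad (BA_left S (2*n)) (BA_right S (2*n)) x \<beta>) \<and>
    (\<forall>\<beta>\<in>pts (levB S 0). B2 \<beta> = ad (BB_left S (2*n)) (BB_right S (2*n)) y \<beta>) \<and>
    (\<forall>a\<in>pts (levA S 0). A2 a = 0) \<and>
    (\<forall>a\<in>pts (levA S 0). A1 a = ad (AA_left S (2*n)) (AA_right S (2*n)) x a
                            + mix_left_even S n a y - mix_right_even S n y a)"
    (is "?L \<longleftrightarrow> ?R")
proof -
  have comp: "bounded_linear_map (levA S 0) (levA S (2*n)) A1"
    "bounded_linear_map (levA S 0) (levB S (2*n)) A2"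
    "bounded_linear_map (levB S 0) (levA S (2*n)) B1"
    "bounded_linear_map (levB S 0) (levB S (2*n)) B2"
    using dec by (simp_all add: dup_decomposition_def derivation_def bounded_bimodule_map_def)
  have comp0: "A1 0 = 0" "A2 0 = 0" "B1 0 = 0" "B2 0 = 0"
    using blm0[OF normed_A comp(1)] blm0[OF normed_A comp(2)]
      blm0[OF normed_B comp(3)] blm0[OF normed_B comp(4)] by auto
  have AB: "D (a, \<beta>) = (A1 a + B1 \<beta>, A2 a + B2 \<beta>)"
    if "a \<in> pts (levA S 0)" "\<beta> \<in> pts (levB S 0)" for a \<beta>
    using dec that unfolding dup_decomposition_def by blast
  have ad: "ad (dup_left S (2*n)) (dup_right S (2*n)) (x, y) (a, \<beta>) =
     (ad (AA_left S (2*n)) (AA_right S (2*n)) x a + mix_left_even S n a y - mix_right_even S n y a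
        + ad (BA_left S (2*n)) (BA_right S (2*n)) x \<beta>, ad (BB_left S (2*n)) (BB_right S (2*n)) y \<beta>)"
    if "a \<in> pts (levA S 0)" "\<beta> \<in> pts (levB S 0)" for a \<beta>
    using dup_action_even[OF that n x y] by (simp add: ad_def)
  note zero = actions_zero(1,2,5,6)[OF n x] actions_zero(3,4)[OF n y] mix_even_zero[OF n y]
  show ?thesis
  proof
    assume L: ?L
    have "(A1 a, A2 a) = (ad (AA_left S (2*n)) (AA_right S (2*n)) x a
        + mix_left_even S n a y - mix_right_even S n y a, 0)" if a: "a \<in> pts (levA S 0)" for a
      using bspec[OF L, of "(a, 0)"] a by (simp add: AB ad comp0) (simp add: ad_def zero)
    moreover have "(B1 \<beta>, B2 \<beta>) = (ad (BA_left S (2*n)) (BA_right S (2*n)) x \<beta>,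
        ad (BB_left S (2*n)) (BB_right S (2*n)) y \<beta>)" if \<beta>: "\<beta> \<in> pts (levB S 0)" for \<beta>
      using bspec[OF L, of "(0, \<beta>)"] \<beta> by (simp add: AB ad comp0) (simp add: ad_def zero)
    ultimately show ?R by simp
  next
    assume R: ?R
    show ?L using R by (auto simp: AB ad)
  qed
qed

end

theorem proposition4p6:
  fixes S :: "('k::real_normed_field, 'u::ab_group_add, 'v::ab_group_add) dup_data"
    and n :: nat and D :: "'u \<times> 'v \<Rightarrow> 'u \<times> 'v"
  assumes "banach_algebra (levA S 0) (mulA S)"
    and "banach_algebra (levB S 0) (mulB S)"
    and "banach_bimodule (levB S 0) (mulB S) (levA S 0) (actL S) (actR S)"
    and "compatible_actions S"
    and "dual_tower (2*n) (towA S)"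
    and "dual_tower (2*n) (towB S)"
    and "bounded_linear_map (levDup S 0) (levDup S (2*n)) D"
  shows "(derivation (levDup S 0) (dup_mul S) (levDup S (2*n))
            (dup_left S (2*n)) (dup_right S (2*n)) D
          \<longleftrightarrow> (\<exists>DA1 DA2 DB1 DB2. dup_decomposition S n D DA1 DA2 DB1 DB2))
    \<and> (derivation (levDup S 0) (dup_mul S) (levDup S (2*n))
            (dup_left S (2*n)) (dup_right S (2*n)) D
        \<longrightarrow> (\<forall>DA1 DA2 DB1 DB2. dup_decomposition S n D DA1 DA2 DB1 DB2 \<longrightarrow>
          (\<forall>x\<in>pts (levA S (2*n)). \<forall>y\<in>pts (levB S (2*n)).
            (\<forall>z\<in>pts (levDup S 0).
               D z = ad (dup_left S (2*n)) (dup_right S (2*n)) (x, y) z)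
            \<longleftrightarrow>
            (\<forall>\<beta>\<in>pts (levB S 0). DB1 \<beta> = ad (BA_left S (2*n)) (BA_right S (2*n)) x \<beta>) \<and>
            (\<forall>\<beta>\<in>pts (levB S 0). DB2 \<beta> = ad (BB_left S (2*n)) (BB_right S (2*n)) y \<beta>) \<and>
            (\<forall>a\<in>pts (levA S 0). DA2 a = 0) \<and>
            (\<forall>a\<in>pts (levA S 0). DA1 a = ad (AA_left S (2*n)) (AA_right S (2*n)) x a
                                    + mix_left_even S n a y - mix_right_even S n y a))))"
proof -
  interpret duplication S "2 * n"
    by unfold_locales (use assms in \<open>simp_all add: banach_algebra_def banach_bimodule_def\<close>)
  show ?thesis
  proof (intro conjI impI allI ballI)
    show "derivation (levDup S 0) (dup_mul S) (levDup S (2*n))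
            (dup_left S (2*n)) (dup_right S (2*n)) D
          \<longleftrightarrow> (\<exists>DA1 DA2 DB1 DB2. dup_decomposition S n D DA1 DA2 DB1 DB2)"
      using dup_decomposition_if_derivation[OF order_refl]
        derivation_if_dup_decomposition[OF order_refl assms(7)] by blast
  qed (rule inner_iff_components[OF order_refl])
qed

end
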